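(* Let $D\ge 3$ be an odd integer and let $d$ be a positive integer. Consider the following semidefinite program in the real variables $x^t_{i,j}$, $(i,j,t)\in\mathcal I$: maximize $\displaystyle\sum_{i=0}^{D-1}\binom{2D}{i}x^0_{i,0}+\frac12\binom{2D}{D}x^0_{D,0}$ subject to (1) $x^0_{0,0}=1$; (2) $0\le x^t_{i,j}\le x^0_{i,0}$ for all $(i,j,t)\in\mathcal I$; (3) $x^t_{i,j}=x^{t'}_{i',j'}$ whenever $(i,j,t),(i',j',t')\in\mathcal I$, $0\le i+j-2t\le D$, and $(i',j',i'+j'-2t')$ is a permutation of $(i,j,i+j-2t)$; (4) $x^t_{i,j}=x^{t'}_{i',j'}$ whenever $(i,j,t),(i',j',t')\in\mathcal I$, $D+1\le i+j-2t\le 2D-2$, and $(i',j',2D-(i'+j'-2t'))$ is a permutation of $(i,j,2D-(i+j-2t))$; (5) $x^t_{i,j}=0$ whenever $\{i,j,i+j-2t,2D-(i+j-2t)\}\cap\{1,2,\dots,d-1\}\neq\emptyset$; (6) for each even $r\in\{0,2,\dots,D-1\}$ the two matrices $\Big(\sum_{t}\beta^r_{i,j,t}x^t_{i,j}\Big)_{i,j=r}^{D}$ and $\Big(\sum_{t}\beta^r_{i,j,t}(x^0_{\zeta,0}-x^t_{i,j})\Big)_{i,j=r}^{D}$ are positive semidefinite, and for each odd $r\in\{1,3,\dots,D-2\}$ the two matrices $\Big(\sum_{t}\beta^r_{i,j,t}x^t_{i,j}\Big)_{i,j=r}^{D-1}$ and $\Big(\sum_{t}\beta^r_{i,j,t}(x^0_{\zeta,0}-x^t_{i,j})\Big)_{i,j=r}^{D-1}$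 are positive semidefinite; here each sum runs over all $t$ with $(i,j,t)\in\mathcal I$, and $\zeta=\min\{i+j-2t,\,2D-(i+j-2t)\}$. Then the optimal value of this semidefinite program is an upper bound on $A(\square_{2D},d)$.
   Context: Let $S=\{1,\dots,2D\}$ and let $X$ be the set of unordered pairs $\{u,u'\}$ of subsets of $S$ with $u\cap u'=\emptyset$ and $u\cup u'=S$. The folded $2D$-cube $\square_{2D}$ is the graph with vertex set $X$ whose path-length distance is $\partial(x,y)=\min\{|x_1\triangle y_1|,|x_1\triangle y_2|\}$ for $x=\{x_1,x_2\}$, $y=\{y_1,y_2\}$; it is distance-regular with diameter $D$. For a graph $\Gamma$, $A(\Gamma,d)$ is the maximum size of a set $C$ of vertices with $\partial(x,y)\ge d$ for all distinct $x,y\in C$. Index set: $\mathcal I=\{(i,j,t)\in\mathbb Z^3: 0\le t\le i,j\le D,\ i+j-t\le 2D-2,\ t\ge\lfloor (j+1)/2\rfloor \text{ if } i=D,\ t\ge\lfloor (i+1)/2\rfloor\text{ if } j=D\}$. Binomial coefficients $\binom ab$ are $0$ unless $0\le b\le a$. The coefficients $\beta^r_{i,j,t}$ are: (a) for $0\le i,j\le D-1$: $\beta^r_{i,j,t}=\binom{2D-2r}{i-r}\sum_{l=0}^{D-1}(-1)^{r-l}\binom rl\binom{i-l}{t-l}\binom{2D-i-r+l}{j-r-t+l}$; (b) for $i=D$, $0\le j\le D-1$ ($r$ even): $\beta^r_{D,j,t}=2\binom{2D-2r}{D-r}\Big(\sum_{l=\lfloor r/2\rfloor+1}^{D-1}(-1)^{r-l}\binom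 rl\big(\binom{D-l}{t-l}\binom{D-r+l}{j-t-r+l}+\binom{D-r+l}{t-r+l}\binom{D-l}{j-t-l}\big)+\binom{D-r/2}{t-r/2}\binom{D-r/2}{j-t-r/2}(-1)^{r/2}\binom{r}{r/2}\Big)$; (c) for $0\le i\le D-1$, $j=D$: $\beta^r_{i,D,t}=\binom{2D-2r}{i-r}\sum_{l=0}^{D-1}(-1)^{r-l}\binom rl\big(\binom{i-l}{t-l}\binom{2D-r-i+l}{D-r-t+l}+\binom{i-l}{t}\binom{2D-r-i+l}{D-t}\big)$; (d) for $i=j=D$ and $0\le r\le D-1$ ($r$ even): $\beta^r_{D,D,t}=2\binom{2D-2r}{D-r}\Big(\sum_{l=\lfloor r/2\rfloor+1}^{D-1}2(-1)^{r-l}\binom rl\big(\binom{D-l}{t-l}\binom{D-r+l}{t}+\binom{D-l}{t}\binom{D-r+l}{D-t}\big)+2(-1)^{r/2}\binom{r}{r/2}\binom{D-r/2}{D-t}\binom{D-r/2}{t}\Big)$.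
   Formalization: The coefficients β in (b) and (c) are halved when 2t equals the index other than D (as printed, D=3, d=1 gives a bound of at most 27 although A=32), and d ≤ 2D is assumed (for d > 2D, constraint (5) at (0,0,0) contradicts (1)). *)

theory Defs
  imports "HOL-Analysis.Analysis" "HOL-Library.Multiset"
begin

definition folded_cube_verts :: "nat \<Rightarrow> nat set set set" where
  "folded_cube_verts D = {{u, u'} |u u'. u \<inter> u' = {} \<and> u \<union> u' = {1..2*D}}"

text \<open>On vertices, replacing both representatives by their complements does not change
  the size of the symmetric difference, so the minimum over all four choices of
  representatives is the minimum over two of them; see \<open>folded_cube_dist_eq\<close>.\<close>

definition folded_cube_dist :: "nat set set \<Rightarrow> nat set set \<Rightarrow> nat" where
  "folded_cube_dist x y = Min {card (sym_diff a b) |a b. a \<in> x \<and> b \<in> y}"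

lemma folded_cube_dist_eq:
  assumes "x1 \<inter> x2 = {}" "x1 \<union> x2 = {1..2*D}" "y1 \<inter> y2 = {}" "y1 \<union> y2 = {1..2*D}"
  shows "folded_cube_dist {x1, x2} {y1, y2} = min (card (sym_diff x1 y1)) (card (sym_diff x1 y2))"
proof -
  have "sym_diff x2 y2 = sym_diff x1 y1" "sym_diff x2 y1 = sym_diff x1 y2"
    using assms by blast+
  then have "{card (sym_diff a b) |a b. a \<in> {x1, x2} \<and> b \<in> {y1, y2}}
      = {card (sym_diff x1 y1), card (sym_diff x1 y2)}"
    by (auto; metis)
  then show ?thesis
    by (simp add: folded_cube_dist_def)
qed

definition folded_cube_edges :: "nat \<Rightarrow> (nat set set) rel" where
  "folded_cube_edges D = {(x, y). x \<in> folded_cube_verts D \<and> y \<in> folded_cube_verts D \<and>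
     folded_cube_dist x y = 1}"

lemma folded_cube_dist_le:
  assumes "x \<in> folded_cube_verts D" "y \<in> folded_cube_verts D" "a \<in> x" "b \<in> y"
  shows "folded_cube_dist x y \<le> card (sym_diff a b)"
proof -
  have "finite x" "finite y" using assms by (auto simp: folded_cube_verts_def)
  then have "finite ((\<lambda>(a,b). card (sym_diff a b)) ` (x \<times> y))" by blast
  moreover have "(\<lambda>(a,b). card (sym_diff a b)) ` (x \<times> y) = {card (sym_diff a b) |a b. a \<in> x \<and> b \<in> y}"
    by force
  ultimately show ?thesis unfolding folded_cube_dist_def using assms(3,4) by (intro Min_le) auto
qed

lemma folded_cube_dist_attained:
  assumes "x \<in> folded_cube_verts D" "y \<in> folded_cube_verts D" "a \<in> x"
  obtains b where "b \<in> y" "card (sym_diff a b) = folded_cube_dist x y"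
proof -
  obtain y1 y2 where y: "y = {y1, y2}" "y1 \<inter> y2 = {}" "y1 \<union> y2 = {1..2*D}"
    using assms(2) by (auto simp: folded_cube_verts_def)
  obtain a' where x: "x = {a, a'}" "a \<inter> a' = {}" "a \<union> a' = {1..2*D}"
    using assms(1,3) unfolding folded_cube_verts_def by blast
  show ?thesis
    using that folded_cube_dist_eq[OF x(2,3) y(2,3)] unfolding x(1) y(1)
    by (metis insertCI min_def)
qed

lemma folded_cube_rep:
  assumes "x \<in> folded_cube_verts D" "a \<in> x"
  shows "a \<subseteq> {1..2*D}" "x = {a, {1..2*D} - a}" "finite a"
proof -
  obtain a' where x: "x = {a, a'}" "a \<inter> a' = {}" "a \<union> a' = {1..2*D}"
    using assms unfolding folded_cube_verts_def by blast
  then show "a \<subseteq> {1..2*D}" by blast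
  then show "finite a" using finite_subset by blast
  have "a' = {1..2*D} - a" using x by blast
  then show "x = {a, {1..2*D} - a}" using x by blast
qed

lemma folded_cube_vert: "a \<subseteq> {1..2*D} \<Longrightarrow> {a, {1..2*D} - a} \<in> folded_cube_verts D"
  unfolding folded_cube_verts_def by blast

lemma folded_cube_dist_triangle:
  assumes "x \<in> folded_cube_verts D" "y \<in> folded_cube_verts D" "z \<in> folded_cube_verts D"
  shows "folded_cube_dist x y \<le> folded_cube_dist x z + folded_cube_dist z y"
proof -
  obtain a where a: "a \<in> x" using assms(1) unfolding folded_cube_verts_def by blast
  obtain c where c: "c \<in> z" "card (sym_diff a c) = folded_cube_dist x z"
    using folded_cube_dist_attained assms a by metis
  obtain b where b: "b \<in> y" "card (sym_diff c b) = folded_cube_dist z y"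
    using folded_cube_dist_attained assms c(1) by metis
  have fin: "finite a" "finite b" "finite c" using folded_cube_rep(3) assms a b(1) c(1) by metis+
  have "card (sym_diff a b) \<le> card (sym_diff a c \<union> sym_diff c b)"
    using fin by (intro card_mono) auto
  also have "\<dots> \<le> card (sym_diff a c) + card (sym_diff c b)" by (rule card_Un_le)
  finally show ?thesis
    using folded_cube_dist_le[OF assms(1,2) a b(1)] b(2) c(2) by linarith
qed

lemma folded_cube_dist_path_le:
  assumes "(x, y) \<in> folded_cube_edges D ^^ n" "x \<in> folded_cube_verts D"
  shows "y \<in> folded_cube_verts D \<and> folded_cube_dist x y \<le> n"
  using assms(1)
proof (induction n arbitrary: y)
  case 0
  obtain a where a: "a \<in> x" using assms(2) unfolding folded_cube_verts_def by blast
  have "folded_cube_dist x x \<le> 0" using folded_cube_dist_le[OF assms(2,2) a a] by simp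
  then show ?case using 0 assms(2) by simp
next
  case (Suc n)
  then obtain z where z: "(x, z) \<in> folded_cube_edges D ^^ n" "(z, y) \<in> folded_cube_edges D" by auto
  have "z \<in> folded_cube_verts D" "folded_cube_dist x z \<le> n" using Suc.IH[OF z(1)] by auto
  moreover have "y \<in> folded_cube_verts D" "folded_cube_dist z y = 1"
    using z(2) by (auto simp: folded_cube_edges_def)
  ultimately show ?case using folded_cube_dist_triangle[OF assms(2), of y z] by simp
qed

lemma folded_cube_path_exists:
  assumes "x \<in> folded_cube_verts D" "y \<in> folded_cube_verts D" "folded_cube_dist x y = n"
  shows "(x, y) \<in> folded_cube_edges D ^^ n"
  using assms
proof (induction n arbitrary: x)
  case 0
  obtain a where a: "a \<in> x" using 0(1) unfolding folded_cube_verts_def by blast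
  obtain b where b: "b \<in> y" "card (sym_diff a b) = 0"
    using folded_cube_dist_attained[OF 0(1,2) a] 0(3) by metis
  have "finite a" "finite b" using folded_cube_rep(3) 0 a b by metis+
  then have "a = b" using b(2) by auto
  then have "x = y" using folded_cube_rep(2)[OF 0(1) a] folded_cube_rep(2)[OF 0(2) b(1)] by simp
  then show ?case by simp
next
  case (Suc n)
  obtain a where a: "a \<in> x" using Suc(2) unfolding folded_cube_verts_def by blast
  obtain b where b: "b \<in> y" "card (sym_diff a b) = Suc n"
    using folded_cube_dist_attained[OF Suc(2,3) a] Suc(4) by metis
  note ra = folded_cube_rep[OF Suc(2) a] and rb = folded_cube_rep[OF Suc(3) b(1)]
  have "sym_diff a b \<noteq> {}" using b(2) by (metis card.empty nat.distinct(1))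
  then obtain e where e: "e \<in> sym_diff a b" by blast
  define c where "c = sym_diff a {e}"
  have cS: "c \<subseteq> {1..2*D}" using e ra(1) rb(1) unfolding c_def by blast
  define z where "z = {c, {1..2*D} - c}"
  have z: "z \<in> folded_cube_verts D" "c \<in> z" using folded_cube_vert[OF cS] unfolding z_def by auto
  have "sym_diff a c = {e}" "sym_diff c b = sym_diff a b - {e}"
    using e unfolding c_def by auto
  then have "card (sym_diff a c) = 1" "card (sym_diff c b) = n"
    using e b(2) ra(3) rb(3) by auto
  then have "folded_cube_dist x z \<le> 1" "folded_cube_dist z y \<le> n"
    using folded_cube_dist_le[OF Suc(2) z(1) a z(2)] folded_cube_dist_le[OF z(1) Suc(3) z(2) b(1)] by auto
  moreover have "Suc n \<le> folded_cube_dist x z + folded_cube_dist z y"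
    using folded_cube_dist_triangle[OF Suc(2,3) z(1)] Suc(4) by simp
  ultimately have "folded_cube_dist x z = 1" "folded_cube_dist z y = n" by auto
  then have "(x, z) \<in> folded_cube_edges D" "(z, y) \<in> folded_cube_edges D ^^ n"
    using Suc.IH[OF z(1) Suc(3)] Suc(2) z(1) by (auto simp: folded_cube_edges_def)
  then show ?case by (rule relpow_Suc_I2)
qed

lemma folded_cube_dist_is_path_dist:
  assumes "x \<in> folded_cube_verts D" "y \<in> folded_cube_verts D"
  shows "folded_cube_dist x y = (LEAST n. (x, y) \<in> folded_cube_edges D ^^ n)"
  using folded_cube_path_exists[OF assms] folded_cube_dist_path_le[OF _ assms(1)]
  by (intro Least_equality[symmetric]) auto

definition max_code_size :: "'a set \<Rightarrow> ('a \<Rightarrow> 'a \<Rightarrow> nat) \<Rightarrow> nat \<Rightarrow> nat" where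
  "max_code_size V dst d =
     Max {card C |C. C \<subseteq> V \<and> (\<forall>x\<in>C. \<forall>y\<in>C. x \<noteq> y \<longrightarrow> d \<le> dst x y)}"

definition ibinom :: "int \<Rightarrow> int \<Rightarrow> real" where
  "ibinom a b = (if 0 \<le> b \<and> b \<le> a then real (nat a choose nat b) else 0)"

definition index_set :: "int \<Rightarrow> (int \<times> int \<times> int) set" where
  "index_set D = {(i, j, t). 0 \<le> t \<and> t \<le> i \<and> t \<le> j \<and> i \<le> D \<and> j \<le> D \<and> i + j - t \<le> 2*D - 2 \<and>
     (i = D \<longrightarrow> (j + 1) div 2 \<le> t) \<and> (j = D \<longrightarrow> (i + 1) div 2 \<le> t)}"

definition beta_formula :: "int \<Rightarrow> int \<Rightarrow> int \<Rightarrow> int \<Rightarrow> int \<Rightarrow> real" where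
  "beta_formula D r i j t =
    (if i < D \<and> j < D then
       ibinom (2*D - 2*r) (i - r) *
       (\<Sum>l=0..D-1. (-1) powi (r - l) * ibinom r l *
          ibinom (i - l) (t - l) * ibinom (2*D - i - r + l) (j - r - t + l))
     else if i = D \<and> j < D then
       2 * ibinom (2*D - 2*r) (D - r) *
       ((\<Sum>l = r div 2 + 1..D-1. (-1) powi (r - l) * ibinom r l *
           (ibinom (D - l) (t - l) * ibinom (D - r + l) (j - t - r + l) +
            ibinom (D - r + l) (t - r + l) * ibinom (D - l) (j - t - l))) +
        ibinom (D - r div 2) (t - r div 2) * ibinom (D - r div 2) (j - t - r div 2) *
        (-1) powi (r div 2) * ibinom r (r div 2))
     else if i < D \<and> j = D then
       ibinom (2*D - 2*r) (i - r) *
       (\<Sum>l=0..D-1. (-1) powi (r - l) * ibinom r l *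
          (ibinom (i - l) (t - l) * ibinom (2*D - r - i + l) (D - r - t + l) +
           ibinom (i - l) t * ibinom (2*D - r - i + l) (D - t)))
     else
       2 * ibinom (2*D - 2*r) (D - r) *
       ((\<Sum>l = r div 2 + 1..D-1. 2 * (-1) powi (r - l) * ibinom r l *
           (ibinom (D - l) (t - l) * ibinom (D - r + l) t +
            ibinom (D - l) t * ibinom (D - r + l) (D - t))) +
        2 * (-1) powi (r div 2) * ibinom r (r div 2) *
        ibinom (D - r div 2) (D - t) * ibinom (D - r div 2) t))"

text \<open>A vertex at distance \<open>D\<close> from the base vertex \<open>{\<emptyset>, S}\<close> is a pair \<open>{v, S - v}\<close> with
  \<open>card v = D\<close>. If \<open>card u = i < D\<close> and \<open>card (u \<inter> v) = t\<close>, then \<open>card (u \<inter> (S - v)) = i - t\<close>,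
  and the two summands in the formulas for exactly one index equal to \<open>D\<close> account for these
  two intersection sizes. When \<open>2 * t = i\<close> they coincide and the same vertices are counted
  twice, whence the factor \<open>1/2\<close>. Without it the semidefinite program is not a relaxation:
  for \<open>D = 3\<close> the minor of the \<open>r = 0\<close> matrix on the rows \<open>0\<close> and \<open>D\<close> forces the variable
  with index \<open>(D, 0, 0)\<close> to be at most \<open>1/2\<close>, so that the optimal value for \<open>d = 1\<close>
  is at most \<open>27\<close>, whereas the graph has \<open>32\<close> vertices.\<close>

definition beta :: "int \<Rightarrow> int \<Rightarrow> int \<Rightarrow> int \<Rightarrow> int \<Rightarrow> real" where
  "beta D r i j t =
    (if (i = D \<and> j < D \<and> 2*t = j) \<or> (i < D \<and> j = D \<and> 2*t = i)
     then beta_formula D r i j t / 2 else beta_formula D r i j t)"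

definition psd_on :: "'i set \<Rightarrow> ('i \<Rightarrow> 'i \<Rightarrow> real) \<Rightarrow> bool" where
  "psd_on K M \<longleftrightarrow> (\<forall>i\<in>K. \<forall>j\<in>K. M i j = M j i) \<and>
     (\<forall>v. 0 \<le> (\<Sum>i\<in>K. \<Sum>j\<in>K. v i * M i j * v j))"

definition zeta :: "int \<Rightarrow> int \<Rightarrow> int \<Rightarrow> int \<Rightarrow> int" where
  "zeta D i j t = min (i + j - 2*t) (2*D - (i + j - 2*t))"

definition sdp_matrix1 ::
    "int \<Rightarrow> (int \<Rightarrow> int \<Rightarrow> int \<Rightarrow> real) \<Rightarrow> int \<Rightarrow> int \<Rightarrow> int \<Rightarrow> real" where
  "sdp_matrix1 D x r i j = (\<Sum>t | (i, j, t) \<in> index_set D. beta D r i j t * x i j t)"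

definition sdp_matrix2 ::
    "int \<Rightarrow> (int \<Rightarrow> int \<Rightarrow> int \<Rightarrow> real) \<Rightarrow> int \<Rightarrow> int \<Rightarrow> int \<Rightarrow> real" where
  "sdp_matrix2 D x r i j =
     (\<Sum>t | (i, j, t) \<in> index_set D. beta D r i j t * (x (zeta D i j t) 0 0 - x i j t))"

text \<open>The variable with subscripts \<open>i, j\<close> and superscript \<open>t\<close> is \<open>x i j t\<close>; values of \<open>x\<close> outside
  \<open>index_set D\<close> play no role. For \<open>d > 2 * D\<close> the set is empty: the vanishing condition at
  \<open>(0, 0, 0)\<close>, where \<open>2 * D - (i + j - 2 * t) = 2 * D\<close>, contradicts \<open>x 0 0 0 = 1\<close>.\<close>

definition sdp_feasible :: "int \<Rightarrow> int \<Rightarrow> (int \<Rightarrow> int \<Rightarrow> int \<Rightarrow> real) set" where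
  "sdp_feasible D d = {x.
     x 0 0 0 = 1 \<and>
     (\<forall>(i, j, t) \<in> index_set D. 0 \<le> x i j t \<and> x i j t \<le> x i 0 0) \<and>
     (\<forall>(i, j, t) \<in> index_set D. \<forall>(i', j', t') \<in> index_set D.
        0 \<le> i + j - 2*t \<and> i + j - 2*t \<le> D \<and>
        {#i', j', i' + j' - 2*t'#} = {#i, j, i + j - 2*t#} \<longrightarrow>
        x i j t = x i' j' t') \<and>
     (\<forall>(i, j, t) \<in> index_set D. \<forall>(i', j', t') \<in> index_set D.
        D + 1 \<le> i + j - 2*t \<and> i + j - 2*t \<le> 2*D - 2 \<and>
        {#i', j', 2*D - (i' + j' - 2*t')#} = {#i, j, 2*D - (i + j - 2*t)#} \<longrightarrow>
        x i j t = x i' j' t') \<and>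
     (\<forall>(i, j, t) \<in> index_set D.
        {i, j, i + j - 2*t, 2*D - (i + j - 2*t)} \<inter> {1..d - 1} \<noteq> {} \<longrightarrow> x i j t = 0) \<and>
     (\<forall>r \<in> {0..D - 1}. even r \<longrightarrow>
        psd_on {r..D} (sdp_matrix1 D x r) \<and> psd_on {r..D} (sdp_matrix2 D x r)) \<and>
     (\<forall>r \<in> {1..D - 2}. odd r \<longrightarrow>
        psd_on {r..D - 1} (sdp_matrix1 D x r) \<and> psd_on {r..D - 1} (sdp_matrix2 D x r))}"

definition sdp_objective :: "int \<Rightarrow> (int \<Rightarrow> int \<Rightarrow> int \<Rightarrow> real) \<Rightarrow> real" where
  "sdp_objective D x =
     (\<Sum>i=0..D-1. ibinom (2*D) i * x i 0 0) + 1/2 * ibinom (2*D) D * x D 0 0"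

definition sdp_value :: "int \<Rightarrow> int \<Rightarrow> ereal" where
  "sdp_value D d = (SUP x \<in> sdp_feasible D d. ereal (sdp_objective D x))"

end

theory Submission
  imports Defs "HOL-Computational_Algebra.Polynomial"
begin

text \<open>
  Let \<open>S = {1..2 * D}\<close>, and let the words be the members of the vertices of an optimal code \<open>C\<close>: a family
  of subsets of \<open>S\<close> that is closed under complements. For subsets \<open>u\<close>, \<open>v\<close> of \<open>S\<close> consider the proportion of pairs
  of a word \<open>z\<close> and a permutation \<open>p\<close> of \<open>S\<close> for which the translates of \<open>p u\<close> and \<open>p v\<close> by \<open>z\<close> (with
  respect to symmetric difference) are both words. It depends only on the sizes of \<open>u\<close>, \<open>v\<close> and
  \<open>u \<inter> v\<close>, is invariant under complementing \<open>u\<close> or \<open>v\<close> and under replacing \<open>v\<close> by the symmetric difference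
  of \<open>u\<close> and \<open>v\<close>, and is a positive semidefinite kernel. Its values form a feasible point whose
  objective value is \<open>card C\<close>. The second family of matrices arises in the same way when \<open>z\<close> ranges
  over the non-words.

  The matrices of size \<open>D - r + 1\<close> or \<open>D - r\<close> are the Gram matrices of the kernel on the vectors that send \<open>v\<close> with
  \<open>card v = i\<close> to the product over \<open>m = 1..r\<close> of \<open>[m \<in> v] - [D + m \<in> v]\<close>. These vectors are eigenvectors of
  the relations \<open>card (u \<inter> v) = t\<close>, with the alternating sums in the coefficients \<open>\<beta>\<close> as eigenvalues;
  such a product is invariant under complementation exactly when \<open>r\<close> is even, which is why
  the level \<open>D\<close> occurs for even \<open>r\<close> only.
\<close>

section \<open>Translation and permutation averages of a code\<close>

text \<open>The set \<open>Z\<close> of centres is separate from the code \<open>C\<close> so that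
  the words, the non-words and all of \<open>Pow S\<close> can be taken as centres. The sum is left
  unnormalised; a common denominator is introduced in \<open>corr\<close>.\<close>

definition code_corr ::
    "'a set \<Rightarrow> 'a set set \<Rightarrow> 'a set set \<Rightarrow> 'a set \<Rightarrow> 'a set \<Rightarrow> real" where
  "code_corr S C Z u v = (\<Sum>p | p permutes S. \<Sum>z\<in>Z.
     of_bool (sym_diff z (p ` u) \<in> C) * of_bool (sym_diff z (p ` v) \<in> C))"

lemma code_corr_commute: "code_corr S C Z u v = code_corr S C Z v u"
  by (simp add: code_corr_def mult.commute)

lemma code_corr_nonneg: "0 \<le> code_corr S C Z u v"
  unfolding code_corr_def by (intro sum_nonneg) auto

text \<open>For fixed \<open>p\<close> and \<open>z\<close> the summand is a factor in
  \<open>u\<close> times the same factor in \<open>v\<close>, so the form is a sum of squares once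
  the sums over \<open>u\<close> and \<open>v\<close> are moved inside.\<close>

lemma code_corr_psd:
  fixes S :: "'a set"
  shows "0 \<le> (\<Sum>u\<in>U. \<Sum>v\<in>U. W u * W v * code_corr S C Z u v)"
proof -
  define e where "e p z u = (of_bool (sym_diff z (p ` u) \<in> C) :: real)" for p :: "'a \<Rightarrow> 'a" and z u
  have "(\<Sum>u\<in>U. \<Sum>v\<in>U. W u * W v * code_corr S C Z u v)
      = (\<Sum>u\<in>U. \<Sum>v\<in>U. \<Sum>p | p permutes S. \<Sum>z\<in>Z. (W u * e p z u) * (W v * e p z v))"
    by (simp add: code_corr_def e_def sum_distrib_left mult_ac)
  also have "\<dots> = (\<Sum>u\<in>U. \<Sum>p | p permutes S. \<Sum>v\<in>U. \<Sum>z\<in>Z. (W u * e p z u) * (W v * e p z v))"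
    by (intro sum.cong refl sum.swap)
  also have "\<dots> = (\<Sum>p | p permutes S. \<Sum>u\<in>U. \<Sum>v\<in>U. \<Sum>z\<in>Z. (W u * e p z u) * (W v * e p z v))"
    by (rule sum.swap)
  also have "\<dots> = (\<Sum>p | p permutes S. \<Sum>u\<in>U. \<Sum>z\<in>Z. \<Sum>v\<in>U. (W u * e p z u) * (W v * e p z v))"
    by (intro sum.cong refl sum.swap)
  also have "\<dots> = (\<Sum>p | p permutes S. \<Sum>z\<in>Z. \<Sum>u\<in>U. \<Sum>v\<in>U. (W u * e p z u) * (W v * e p z v))"
    by (intro sum.cong refl sum.swap)
  also have "\<dots> = (\<Sum>p | p permutes S. \<Sum>z\<in>Z. (\<Sum>u\<in>U. W u * e p z u)\<^sup>2)"
    by (simp add: power2_eq_square sum_product)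
  also have "\<dots> \<ge> 0" by (intro sum_nonneg) auto
  finally show ?thesis .
qed

text \<open>Composition with \<open>q\<close> only reorders the permutations of
  \<open>S\<close>.\<close>

lemma code_corr_permutes:
  assumes "q permutes S"
  shows "code_corr S C Z (q ` u) (q ` v) = code_corr S C Z u v"
proof -
  define f where "f p = (\<Sum>z\<in>Z. of_bool (sym_diff z (p ` u) \<in> C) *
    (of_bool (sym_diff z (p ` v) \<in> C) :: real))" for p
  have "code_corr S C Z (q ` u) (q ` v) = (\<Sum>p | p permutes S. f (p \<circ> q))"
    by (simp add: code_corr_def f_def image_comp)
  also have "\<dots> = (\<Sum>p | p permutes S. f p)"
    by (rule sum_permutations_compose_right[OF assms, symmetric])
  finally show ?thesis by (simp add: code_corr_def f_def)
qed

text \<open>The three cardinalities fix the sizes of the four cells into which \<open>u\<close> and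
  \<open>v\<close> cut \<open>S\<close>. Bijections between corresponding cells glue to a
  permutation.\<close>

lemma ex_permutes_image_eq2:
  assumes "finite S" "u \<subseteq> S" "v \<subseteq> S" "u' \<subseteq> S" "v' \<subseteq> S"
    and "card u = card u'" "card v = card v'" "card (u \<inter> v) = card (u' \<inter> v')"
  shows "\<exists>p. p permutes S \<and> p ` u = u' \<and> p ` v = v'"
proof -
  have fin: "finite u" "finite v" "finite u'" "finite v'"
    using assms finite_subset by metis+
  have "card (u - v) = card (u' - v')" "card (v - u) = card (v' - u')"
    using assms fin by (auto simp: card_Diff_subset_Int Int_commute)
  moreover have "card (S - (u \<union> v)) = card (S - (u' \<union> v'))"
    using assms fin card_Un_Int[of u v] card_Un_Int[of u' v'] by (simp add: card_Diff_subset)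
  ultimately obtain f1 f2 f3 f4 where f: "bij_betw f1 (u \<inter> v) (u' \<inter> v')"
    "bij_betw f2 (u - v) (u' - v')" "bij_betw f3 (v - u) (v' - u')"
    "bij_betw f4 (S - (u \<union> v)) (S - (u' \<union> v'))"
    using assms fin by (metis finite_same_card_bij finite_Diff finite_Int)
  define p where "p x = (if x \<in> u then if x \<in> v then f1 x else f2 x else if x \<in> v then f3 x
    else if x \<in> S then f4 x else x)" for x
  have p1: "bij_betw p (u \<inter> v) (u' \<inter> v')"
    using f(1) by (rule bij_betw_cong[THEN iffD1, rotated]) (auto simp: p_def)
  have p2: "bij_betw p (u - v) (u' - v')"
    using f(2) by (rule bij_betw_cong[THEN iffD1, rotated]) (auto simp: p_def)
  have p3: "bij_betw p (v - u) (v' - u')"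
    using f(3) by (rule bij_betw_cong[THEN iffD1, rotated]) (auto simp: p_def)
  have p4: "bij_betw p (S - (u \<union> v)) (S - (u' \<union> v'))"
    using f(4) by (rule bij_betw_cong[THEN iffD1, rotated]) (auto simp: p_def)
  have pu: "bij_betw p ((u \<inter> v) \<union> (u - v)) ((u' \<inter> v') \<union> (u' - v'))"
    using p1 p2 by (rule bij_betw_combine) auto
  have pv: "bij_betw p ((u \<inter> v) \<union> (v - u)) ((u' \<inter> v') \<union> (v' - u'))"
    using p1 p3 by (rule bij_betw_combine) auto
  have pw: "bij_betw p (((u \<inter> v) \<union> (u - v)) \<union> (v - u)) (((u' \<inter> v') \<union> (u' - v')) \<union> (v' - u'))"
    using pu p3 by (rule bij_betw_combine) auto
  have pS: "bij_betw p ((((u \<inter> v) \<union> (u - v)) \<union> (v - u)) \<union> (S - (u \<union> v)))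
     ((((u' \<inter> v') \<union> (u' - v')) \<union> (v' - u')) \<union> (S - (u' \<union> v')))"
    using pw p4 by (rule bij_betw_combine) auto
  have eqs: "(u \<inter> v) \<union> (u - v) = u" "(u' \<inter> v') \<union> (u' - v') = u'"
    "(u \<inter> v) \<union> (v - u) = v" "(u' \<inter> v') \<union> (v' - u') = v'"
    "u \<union> (v - u) \<union> (S - (u \<union> v)) = S" "u' \<union> (v' - u') \<union> (S - (u' \<union> v')) = S"
    using assms by auto
  have "bij_betw p S S" using pS by (simp only: eqs)
  moreover have "p x = x" if "x \<notin> S" for x using that assms by (auto simp: p_def)
  ultimately have "p permutes S" by (rule bij_imp_permutes)
  moreover have "p ` u = u'" using pu by (simp only: eqs bij_betw_imp_surj_on)
  moreover have "p ` v = v'" using pv by (simp only: eqs bij_betw_imp_surj_on)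
  ultimately show ?thesis by blast
qed

lemma code_corr_cong_card:
  assumes "finite S" "u \<subseteq> S" "v \<subseteq> S" "u' \<subseteq> S" "v' \<subseteq> S"
    and "card u = card u'" "card v = card v'" "card (u \<inter> v) = card (u' \<inter> v')"
  shows "code_corr S C Z u v = code_corr S C Z u' v'"
  using ex_permutes_image_eq2[OF assms] code_corr_permutes by metis

lemma image_Diff_permutes: "p permutes S \<Longrightarrow> p ` (S - u) = S - p ` u"
  by (simp add: image_set_diff permutes_inj permutes_image)

lemma image_sym_diff_permutes: "p permutes S \<Longrightarrow> p ` sym_diff u v = sym_diff (p ` u) (p ` v)"
  by (simp add: image_Un image_set_diff permutes_inj)

lemma permutes_image_subset: "p permutes S \<Longrightarrow> u \<subseteq> S \<Longrightarrow> p ` u \<subseteq> S"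
  by (metis image_mono permutes_image)

text \<open>Complementing \<open>u\<close> complements every translate by a centre, and membership
  in \<open>C\<close> is invariant under complements.\<close>

lemma code_corr_compl:
  assumes C: "C \<subseteq> Pow S" "\<And>c. c \<in> C \<Longrightarrow> S - c \<in> C" and Z: "Z \<subseteq> Pow S" and u: "u \<subseteq> S"
  shows "code_corr S C Z (S - u) v = code_corr S C Z u v"
proof -
  have "sym_diff z (p ` (S - u)) \<in> C \<longleftrightarrow> sym_diff z (p ` u) \<in> C"
    if p: "p permutes S" and z: "z \<in> Z" for p z
  proof -
    have w: "p ` u \<subseteq> S" using permutes_image_subset[OF p u] .
    have "sym_diff z (p ` (S - u)) = S - sym_diff z (p ` u)"
      unfolding image_Diff_permutes[OF p] using w z Z by auto
    moreover have "S - (S - sym_diff z (p ` u)) = sym_diff z (p ` u)" using w z Z by auto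
    ultimately show ?thesis using C(2) by metis
  qed
  then show ?thesis unfolding code_corr_def by (intro sum.cong refl) auto
qed

text \<open>For fixed \<open>p\<close>, let \<open>a\<close> be the image of \<open>u\<close>.
  Translation by \<open>a\<close> is an involution on those \<open>z\<close> in \<open>C\<close>
  whose translate by \<open>a\<close> is also in \<open>C\<close>; it turns the translate by the
  image of \<open>v\<close> into the translate by the image of \<open>sym_diff u v\<close>.\<close>

lemma code_corr_sym_diff:
  assumes "finite C"
  shows "code_corr S C C u v = code_corr S C C u (sym_diff u v)"
proof -
  have *: "(\<Sum>z\<in>C. of_bool (sym_diff z a \<in> C) * (of_bool (sym_diff z b \<in> C) :: real))
    = (\<Sum>z\<in>C. of_bool (sym_diff z a \<in> C) * of_bool (sym_diff z (sym_diff a b) \<in> C))" for a b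
  proof -
    let ?T = "{z\<in>C. sym_diff z a \<in> C}"
    have inv: "sym_diff (sym_diff z a) a = z" for z by auto
    have shift: "sym_diff (sym_diff z a) (sym_diff a b) = sym_diff z b" for z by auto
    have "(\<Sum>z\<in>C. of_bool (sym_diff z a \<in> C) * (of_bool (sym_diff z b \<in> C) :: real))
        = (\<Sum>z\<in>?T. of_bool (sym_diff z b \<in> C))"
      using assms by (intro sum.mono_neutral_cong_right) auto
    also have "\<dots> = (\<Sum>z\<in>?T. of_bool (sym_diff z (sym_diff a b) \<in> C))"
      by (rule sum.reindex_bij_witness[where i = "\<lambda>z. sym_diff z a" and j = "\<lambda>z. sym_diff z a"])
        (simp_all only: mem_Collect_eq inv shift simp_thms)
    also have "\<dots> = (\<Sum>z\<in>C. of_bool (sym_diff z a \<in> C) * of_bool (sym_diff z (sym_diff a b) \<in> C))"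
      using assms by (intro sum.mono_neutral_cong_left) auto
    finally show ?thesis .
  qed
  show ?thesis unfolding code_corr_def
  proof (rule sum.cong[OF refl])
    fix p assume "p \<in> {p. p permutes S}"
    then have p: "p permutes S" by simp
    show "(\<Sum>z\<in>C. of_bool (sym_diff z (p ` u) \<in> C) * (of_bool (sym_diff z (p ` v) \<in> C) :: real))
      = (\<Sum>z\<in>C. of_bool (sym_diff z (p ` u) \<in> C) * of_bool (sym_diff z (p ` sym_diff u v) \<in> C))"
      unfolding image_sym_diff_permutes[OF p] by (rule *)
  qed
qed

text \<open>When the centre is an arbitrary subset of \<open>S\<close>, its translate by the image
  of \<open>u\<close> is a freely chosen word. With that word as the new centre, only the translate
  by the image of \<open>sym_diff u v\<close> is left to test.\<close>

lemma code_corr_Pow: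
  assumes "finite S" "C \<subseteq> Pow S" "u \<subseteq> S"
  shows "code_corr S C (Pow S) u v = code_corr S C C (sym_diff u v) {}"
proof -
  have *: "(\<Sum>z\<in>Pow S. of_bool (sym_diff z a \<in> C) * (of_bool (sym_diff z b \<in> C) :: real))
    = (\<Sum>z\<in>C. of_bool (sym_diff z (sym_diff a b) \<in> C))" if a: "a \<subseteq> S" for a b
  proof -
    have inv: "sym_diff (sym_diff z a) a = z" for z by auto
    have shift: "sym_diff (sym_diff z a) (sym_diff a b) = sym_diff z b" for z by auto
    have "sym_diff z a \<subseteq> S" if "z \<in> C" for z
      using that a assms(2) by auto
    have "(\<Sum>z\<in>Pow S. of_bool (sym_diff z a \<in> C) * (of_bool (sym_diff z b \<in> C) :: real))
        = (\<Sum>z\<in>{z\<in>Pow S. sym_diff z a \<in> C}. of_bool (sym_diff z b \<in> C))"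
      using assms by (intro sum.mono_neutral_cong_right) auto
    also have "\<dots> = (\<Sum>z\<in>C. of_bool (sym_diff z (sym_diff a b) \<in> C))"
      by (rule sum.reindex_bij_witness[where i = "\<lambda>z. sym_diff z a" and j = "\<lambda>z. sym_diff z a"])
        (use \<open>\<And>z. z \<in> C \<Longrightarrow> sym_diff z a \<subseteq> S\<close> in
          \<open>simp_all only: mem_Collect_eq inv shift simp_thms Pow_iff\<close>)
    finally show ?thesis .
  qed
  show ?thesis unfolding code_corr_def
  proof (rule sum.cong[OF refl])
    fix p assume "p \<in> {p. p permutes S}"
    then have p: "p permutes S" by simp
    have e: "sym_diff z (p ` {}) = z" for z by simp
    show "(\<Sum>z\<in>Pow S. of_bool (sym_diff z (p ` u) \<in> C) * (of_bool (sym_diff z (p ` v) \<in> C) :: real))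
      = (\<Sum>z\<in>C. of_bool (sym_diff z (p ` sym_diff u v) \<in> C) * of_bool (sym_diff z (p ` {}) \<in> C))"
      unfolding image_sym_diff_permutes[OF p] e *[OF permutes_image_subset[OF p assms(3)]]
      by (rule sum.cong) simp_all
  qed
qed

lemma code_corr_Diff:
  assumes "finite Z" "Y \<subseteq> Z"
  shows "code_corr S C (Z - Y) u v = code_corr S C Z u v - code_corr S C Y u v"
  unfolding code_corr_def sum_subtractf[symmetric] by (intro sum.cong refl sum_diff assms)

text \<open>With \<open>{}\<close> in the second place the second indicator is 1, because the centre
  itself lies in \<open>C\<close>.\<close>

lemma code_corr_le_empty: "code_corr S C C u v \<le> code_corr S C C u {}"
  unfolding code_corr_def by (intro sum_mono) auto

lemma code_corr_empty_empty:
  "finite S \<Longrightarrow> code_corr S C C {} {} = fact (card S) * card C"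
  by (simp add: code_corr_def card_permutations)

text \<open>For fixed \<open>p\<close> and \<open>z\<close>, the translates by \<open>z\<close> of
  the images of all \<open>u\<close> run through \<open>Pow S\<close> exactly once, so each pair of
  \<open>p\<close> and \<open>z\<close> contributes \<open>card C\<close>.\<close>

lemma sum_code_corr_empty:
  assumes "finite S" "C \<subseteq> Pow S"
  shows "(\<Sum>u\<in>Pow S. code_corr S C C u {}) = fact (card S) * (card C)\<^sup>2"
proof -
  have "(\<Sum>u\<in>Pow S. of_bool (sym_diff z (p ` u) \<in> C)) = real (card C)"
    if p: "p permutes S" and z: "z \<in> C" for p z
  proof -
    have zS: "z \<subseteq> S" using z assms by auto
    let ?q = "inv p"
    have q: "?q permutes S" using permutes_inv[OF p] .
    have pq: "p ` ?q ` w = w" "?q ` p ` w = w" for w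
      using p by (simp_all add: image_comp permutes_inv_o)
    have inv: "sym_diff z (sym_diff z w) = w" for w by auto
    have "(\<Sum>u\<in>Pow S. of_bool (sym_diff z (p ` u) \<in> C)) = (\<Sum>w\<in>Pow S. of_bool (w \<in> C) :: real)"
    proof (rule sum.reindex_bij_witness[where i = "\<lambda>w. ?q ` sym_diff z w" and
          j = "\<lambda>u. sym_diff z (p ` u)"])
      fix a assume a: "a \<in> Pow S"
      show "?q ` sym_diff z (sym_diff z (p ` a)) = a" unfolding inv pq ..
      show "sym_diff z (p ` a) \<in> Pow S" using zS permutes_image_subset[OF p] a by blast
      show "sym_diff z (p ` ?q ` sym_diff z a) = a" unfolding inv pq ..
      have "sym_diff z a \<subseteq> S" using zS a by blast
      then show "?q ` sym_diff z a \<in> Pow S" using permutes_image_subset[OF q] by blast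
    qed simp
    also have "\<dots> = (\<Sum>w\<in>C. 1)"
      using assms by (intro sum.mono_neutral_cong_right) auto
    finally show ?thesis by simp
  qed note * = this
  have "(\<Sum>u\<in>Pow S. code_corr S C C u {})
      = (\<Sum>u\<in>Pow S. \<Sum>p | p permutes S. \<Sum>z\<in>C. of_bool (sym_diff z (p ` u) \<in> C))"
    unfolding code_corr_def by (intro sum.cong refl) simp
  also have "\<dots> = (\<Sum>p | p permutes S. \<Sum>u\<in>Pow S. \<Sum>z\<in>C. of_bool (sym_diff z (p ` u) \<in> C))"
    by (rule sum.swap)
  also have "\<dots> = (\<Sum>p | p permutes S. \<Sum>z\<in>C. \<Sum>u\<in>Pow S. of_bool (sym_diff z (p ` u) \<in> C))"
    by (intro sum.cong refl sum.swap)
  also have "\<dots> = (\<Sum>p | p permutes S. \<Sum>z\<in>C. real (card C))"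
    by (intro sum.cong refl *) auto
  also have "\<dots> = fact (card S) * (card C)\<^sup>2"
    using assms by (simp add: card_permutations power2_eq_square)
  finally show ?thesis .
qed

lemma code_corr_nonzeroD:
  assumes "code_corr S C C u v \<noteq> 0" 
  obtains p z where "p permutes S" "z \<in> C" "sym_diff z (p ` u) \<in> C" "sym_diff z (p ` v) \<in> C"
proof -
  obtain p where p: "p permutes S" "(\<Sum>z\<in>C. of_bool (sym_diff z (p ` u) \<in> C) * (of_bool (sym_diff z (p ` v) \<in> C) :: real)) \<noteq> 0"
    using assms unfolding code_corr_def by (metis (mono_tags, lifting) mem_Collect_eq sum.neutral)
  then obtain z where "z \<in> C" "of_bool (sym_diff z (p ` u) \<in> C) * (of_bool (sym_diff z (p ` v) \<in> C) :: real) \<noteq> 0"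
    by (metis (mono_tags, lifting) sum.neutral)
  then show ?thesis using that p by (auto split: if_splits)
qed

section \<open>Harmonic vectors on the levels of the cube\<close>

lemma ibinom_of_nat [simp]: "ibinom (int a) (int b) = real (a choose b)"
  by (simp add: ibinom_def binomial_eq_0)

lemma ibinom_symmetric: "ibinom a (a - b) = ibinom a b"
proof (cases "0 \<le> b \<and> b \<le> a")
  case True
  then have "nat (a - b) = nat a - nat b" by (simp add: nat_diff_distrib)
  moreover have "nat a choose nat b = nat a choose (nat a - nat b)"
    using True by (intro binomial_symmetric nat_mono) simp
  ultimately show ?thesis using True by (simp add: ibinom_def)
qed (auto simp: ibinom_def)

text \<open>Beyond \<open>A\<close>, such a \<open>v\<close> is a choice of elements of
  \<open>u - A\<close> and, independently, of elements of \<open>S - u - A\<close>. The integer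
  arguments make \<open>ibinom\<close> vanish when \<open>A\<close> is too large inside
  \<open>u\<close> for \<open>s\<close>, or outside \<open>u\<close> for
  \<open>j - s\<close>.\<close>

lemma card_supersets_card_inter:
  assumes S: "finite S" "A \<subseteq> S" "u \<subseteq> S"
  shows "real (card {v. v \<subseteq> S \<and> A \<subseteq> v \<and> card v = j \<and> card (u \<inter> v) = s}) =
    ibinom (int (card u) - int (card (A \<inter> u))) (int s - int (card (A \<inter> u))) *
    ibinom (int (card S) - int (card u) - int (card (A - u))) (int j - int s - int (card (A - u)))"
    (is "real (card ?V) = _")
proof -
  have fin: "finite A" "finite u" using S finite_subset by metis+
  define l m where "l = card (A \<inter> u)" and "m = card (A - u)"
  have cu: "card (u - A) = card u - l" "l \<le> card u"
    using fin by (auto simp: l_def card_Diff_subset_Int Int_commute card_mono)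
  have "A - u \<subseteq> S - u" using S by auto
  then have cS: "card (S - u - A) = card S - card u - m" "m \<le> card S - card u" "card u \<le> card S"
  proof -
    have "S - u - A = (S - u) - (A - u)" by auto
    then have "card (S - u - A) = card (S - u) - m"
      using \<open>A - u \<subseteq> S - u\<close> fin by (simp add: m_def card_Diff_subset)
    then show "card (S - u - A) = card S - card u - m" using S fin by (simp add: card_Diff_subset)
    show "m \<le> card S - card u"
      using card_mono[OF _ \<open>A - u \<subseteq> S - u\<close>] S fin by (simp add: m_def card_Diff_subset)
    show "card u \<le> card S" using S by (simp add: card_mono)
  qed
  show ?thesis
  proof (cases "l \<le> s \<and> s + m \<le> j")
    case True
    let ?X = "{X. X \<subseteq> u - A \<and> card X = s - l}" and ?Y = "{Y. Y \<subseteq> S - u - A \<and> card Y = j - s - m}"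
    have "bij_betw (\<lambda>(X, Y). A \<union> X \<union> Y) (?X \<times> ?Y) ?V"
    proof (rule bij_betwI[where g = "\<lambda>v. (v \<inter> u - A, v - u - A)"])
      show "(\<lambda>(X, Y). A \<union> X \<union> Y) \<in> ?X \<times> ?Y \<rightarrow> ?V"
      proof (rule funcsetI)
        fix q assume "q \<in> ?X \<times> ?Y"
        then obtain X Y where q: "q = (X, Y)" and X: "X \<subseteq> u - A" "card X = s - l"
          and Y: "Y \<subseteq> S - u - A" "card Y = j - s - m" by auto
        have finXY: "finite X" "finite Y"
          using X(1) Y(1) S fin by (auto intro: finite_subset)
        have "A \<union> X \<union> Y \<subseteq> S" using X Y S by auto
        have "u \<inter> (A \<union> X \<union> Y) = (A \<inter> u) \<union> X" using X Y by auto
        moreover have "card ((A \<inter> u) \<union> X) = l + (s - l)"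
          using X finXY fin by (subst card_Un_disjoint) (auto simp: l_def)
        ultimately have "card (u \<inter> (A \<union> X \<union> Y)) = s" using True by simp
        have "card A = l + m" unfolding l_def m_def
          using card_Int_Diff[OF fin(1), of u] by simp
        moreover have "card (A \<union> X \<union> Y) = card A + (s - l) + (j - s - m)"
        proof -
          have "card (A \<union> X \<union> Y) = card (A \<union> X) + card Y"
            using X(1) Y(1) finXY fin by (intro card_Un_disjoint) auto
          also have "card (A \<union> X) = card A + card X"
            using X(1) finXY fin by (intro card_Un_disjoint) auto
          finally show ?thesis using X(2) Y(2) by simp
        qed
        ultimately have "card (A \<union> X \<union> Y) = j" using True by simp
        then show "(\<lambda>(X, Y). A \<union> X \<union> Y) q \<in> ?V"
          using \<open>card (u \<inter> (A \<union> X \<union> Y)) = s\<close> \<open>A \<union> X \<union> Y \<subseteq> S\<close> by (simp add: q le_supI1)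
      qed
      show "(\<lambda>v. (v \<inter> u - A, v - u - A)) \<in> ?V \<rightarrow> ?X \<times> ?Y"
      proof (rule funcsetI)
        fix v assume "v \<in> ?V"
        then have v: "v \<subseteq> S" "A \<subseteq> v" "card v = j" "card (u \<inter> v) = s" by auto
        have fv: "finite v" using v S finite_subset by metis
        have "v \<inter> u - A = (u \<inter> v) - (A \<inter> u)" by auto
        moreover have "A \<inter> u \<subseteq> u \<inter> v" using v(2) by blast
        ultimately have "card (v \<inter> u - A) = s - l"
          using v(4) fin by (simp add: l_def card_Diff_subset)
        moreover have "card (v - u - A) = j - s - m"
        proof -
          have "v - u - A = (v - u) - (A - u)" by auto
          moreover have "card (v - u) = j - s" using v fv fin by (simp add: card_Diff_subset_Int Int_commute)
          moreover have "A - u \<subseteq> v - u" using v(2) by blast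
          ultimately show ?thesis
            using fin by (simp add: m_def card_Diff_subset)
        qed
        ultimately show "(v \<inter> u - A, v - u - A) \<in> ?X \<times> ?Y" using v by auto
      qed
    next
      fix q assume "q \<in> ?X \<times> ?Y"
      then obtain X Y where q: "q = (X, Y)" and X: "X \<subseteq> u - A" and Y: "Y \<subseteq> S - u - A" by auto
      have "(A \<union> X \<union> Y) \<inter> u - A = X" "(A \<union> X \<union> Y) - u - A = Y" using X Y by blast+
      then show "(\<lambda>v. (v \<inter> u - A, v - u - A)) ((\<lambda>(X, Y). A \<union> X \<union> Y) q) = q"
        by (simp only: q prod.case)
    next
      fix v assume "v \<in> ?V"
      then have "A \<union> (v \<inter> u - A) \<union> (v - u - A) = v" by blast
      then show "(\<lambda>(X, Y). A \<union> X \<union> Y) ((\<lambda>v. (v \<inter> u - A, v - u - A)) v) = v"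
        by (simp only: prod.case)
    qed
    then have "card ?V = card ?X * card ?Y"
      unfolding card_cartesian_product[symmetric] by (rule bij_betw_same_card[symmetric])
    also have "card ?X = (card u - l) choose (s - l)"
      using n_subsets[of "u - A" "s - l"] fin cu by simp
    also have "card ?Y = (card S - card u - m) choose (j - s - m)"
      using n_subsets[of "S - u - A" "j - s - m"] S cS by simp
    finally have "real (card ?V) = real ((card u - l) choose (s - l)) *
      real ((card S - card u - m) choose (j - s - m))" by simp
    moreover have "int (card u) - int l = int (card u - l)" "int s - int l = int (s - l)"
      "int (card S) - int (card u) - int m = int (card S - card u - m)"
      "int j - int s - int m = int (j - s - m)"
      using True cu(2) cS(2,3) by linarith+
    ultimately show ?thesis
      unfolding l_def[symmetric] m_def[symmetric] by (simp only: ibinom_of_nat)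
  next
    case False
    have "?V = {}"
    proof (rule ccontr)
      assume "?V \<noteq> {}"
      then obtain v where v: "v \<subseteq> S" "A \<subseteq> v" "card v = j" "card (u \<inter> v) = s" by auto
      have fv: "finite v" using v S finite_subset by metis
      have "A \<inter> u \<subseteq> u \<inter> v" using v(2) by blast
      then have "l \<le> s" using card_mono[of "u \<inter> v"] v(4) fin by (simp add: l_def)
      moreover have "m \<le> card (v - u)" unfolding m_def using v fv by (intro card_mono) auto
      moreover have "card (v - u) = j - s" "s \<le> j"
        using v fv card_mono[of v "u \<inter> v"] by (simp_all add: card_Diff_subset_Int Int_commute)
      ultimately show False using False by simp
    qed
    then have "card ?V = 0" by (simp only: card.empty)
    moreover have "int s - int l < 0 \<or> int j - int s - int m < 0" using False by linarith
    ultimately show ?thesis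
      unfolding l_def[symmetric] m_def[symmetric] by (auto simp: ibinom_def)
  qed
qed

text \<open>For \<open>r \<le> D\<close>, this function restricted to level \<open>r\<close> is a
  polytabloid of the two-row shape \<open>(2 * D - r, r)\<close>; on a higher level it is the image
  of that vector under the inclusion map between levels.\<close>

definition pair_sign :: "nat \<Rightarrow> nat \<Rightarrow> nat set \<Rightarrow> real" where
  "pair_sign D r v = (\<Prod>m=1..r. of_bool (m \<in> v) - of_bool (D + m \<in> v))"

text \<open>These sets index the terms of the expanded product: \<open>B\<close> records the pairs
  \<open>{m, D + m}\<close> from which \<open>m\<close> is taken.\<close>

definition transversal :: "nat \<Rightarrow> nat \<Rightarrow> nat set \<Rightarrow> nat set" where
  "transversal D r B = B \<union> (\<lambda>m. D + m) ` ({1..r} - B)"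

lemma prod_of_bool: "finite A \<Longrightarrow> (\<Prod>x\<in>A. of_bool (P x)) = (of_bool (\<forall>x\<in>A. P x) :: 'a :: comm_semiring_1)"
  by (induction A rule: finite_induct) auto

lemma pair_sign_expand:
  "pair_sign D r v = (\<Sum>B\<in>Pow {1..r}. (-1) ^ (r - card B) * of_bool (transversal D r B \<subseteq> v))"
proof -
  have "pair_sign D r v = (\<Prod>m=1..r. of_bool (m \<in> v) + - of_bool (D + m \<in> v))"
    by (simp add: pair_sign_def)
  also have "\<dots> = (\<Sum>B\<in>Pow {1..r}. (\<Prod>m\<in>B. of_bool (m \<in> v)) * (\<Prod>m\<in>{1..r} - B. - of_bool (D + m \<in> v)))"
    by (rule prod_add) simp
  also have "\<dots> = (\<Sum>B\<in>Pow {1..r}. (-1) ^ (r - card B) * of_bool (transversal D r B \<subseteq> v))"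
  proof (rule sum.cong[OF refl])
    fix B assume "B \<in> Pow {1..r}"
    then have B: "B \<subseteq> {1..r}" "finite B" using finite_subset by auto
    have "(\<Prod>m\<in>{1..r} - B. - (of_bool (D + m \<in> v) :: real))
      = (\<Prod>m\<in>{1..r} - B. - 1) * (\<Prod>m\<in>{1..r} - B. of_bool (D + m \<in> v))"
      by (subst prod.distrib[symmetric]) simp
    then show "(\<Prod>m\<in>B. of_bool (m \<in> v)) * (\<Prod>m\<in>{1..r} - B. - of_bool (D + m \<in> v)) =
         ((-1) ^ (r - card B) * of_bool (transversal D r B \<subseteq> v) :: real)"
      using B by (simp add: prod_of_bool card_Diff_subset transversal_def) auto
  qed
  finally show ?thesis .
qed

lemma card_transversal_Int:
  assumes "B \<subseteq> {1..r}" "r \<le> D"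
  shows "card (transversal D r B \<inter> u) = (\<Sum>m\<in>B. of_bool (m \<in> u)) + (\<Sum>m\<in>{1..r} - B. of_bool (D + m \<in> u))"
proof -
  have fB: "finite B" using assms finite_subset by auto
  have "transversal D r B \<inter> u = (B \<inter> u) \<union> ((\<lambda>m. D + m) ` ({m\<in>{1..r} - B. D + m \<in> u}))"
    by (auto simp: transversal_def)
  moreover have "(B \<inter> u) \<inter> ((\<lambda>m. D + m) ` ({m\<in>{1..r} - B. D + m \<in> u})) = {}"
    using assms by auto
  moreover have "card ((\<lambda>m. D + m) ` ({m\<in>{1..r} - B. D + m \<in> u})) = card {m\<in>{1..r} - B. D + m \<in> u}"
    by (rule card_image) auto
  ultimately have "card (transversal D r B \<inter> u) = card (B \<inter> u) + card {m\<in>{1..r} - B. D + m \<in> u}"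
    using fB by (simp add: card_Un_disjoint)
  moreover have "card (B \<inter> u) = (\<Sum>m\<in>B. of_bool (m \<in> u))"
    using fB by (simp add: Int_def)
  moreover have "card {m\<in>{1..r} - B. D + m \<in> u} = (\<Sum>m\<in>{1..r} - B. of_bool (D + m \<in> u))"
    by (simp add: Int_def)
  ultimately show ?thesis by simp
qed

lemma card_transversal:
  assumes "B \<subseteq> {1..r}" "r \<le> D"
  shows "card (transversal D r B) = r"
proof -
  have "card B \<le> r" using card_mono[OF _ assms(1)] by simp
  then show ?thesis
    using card_transversal_Int[OF assms, of UNIV] assms by (simp add: card_Diff_subset finite_subset)
qed

text \<open>Both sides are linear in \<open>N\<close>; for \<open>N l = x ^ l\<close> the sum factors over the \<open>r\<close> pairs, and each
  factor \<open>x ^ [m \<in> u] - x ^ [D + m \<in> u]\<close> equals \<open>([m \<in> u] - [D + m \<in> u]) * (x - 1)\<close>.\<close>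

lemma sum_transversals:
  fixes N :: "nat \<Rightarrow> real"
  assumes "r \<le> D"
  shows "(\<Sum>B\<in>Pow {1..r}. (-1) ^ (r - card B) * N (card (transversal D r B \<inter> u)))
    = pair_sign D r u * (\<Sum>l\<le>r. (-1) ^ (r - l) * real (r choose l) * N l)"
proof -
  define P where "P = (\<Sum>B\<in>Pow {1..r}. monom ((-1) ^ (r - card B)) (card (transversal D r B \<inter> u)) :: real poly)"
  have "P = (\<Sum>B\<in>Pow {1..r}. (\<Prod>m\<in>B. monom 1 (of_bool (m \<in> u))) *
      (\<Prod>m\<in>{1..r} - B. monom (-1) (of_bool (D + m \<in> u))))"
    unfolding P_def
  proof (rule sum.cong[OF refl])
    fix B assume "B \<in> Pow {1..r}"
    then have B: "B \<subseteq> {1..r}" "finite B" using finite_subset by auto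
    have pm: "(\<Prod>m\<in>A. monom c (e m)) = monom (c ^ card A) (sum e A)"
      if "finite A" for A :: "nat set" and e :: "nat \<Rightarrow> nat" and c :: real
      using that by (induction A rule: finite_induct) (auto simp: mult_monom one_poly_eq_simps monom_0)
    show "monom ((-1) ^ (r - card B)) (card (transversal D r B \<inter> u)) = (\<Prod>m\<in>B. monom 1 (of_bool (m \<in> u))) *
      (\<Prod>m\<in>{1..r} - B. monom (-1 :: real) (of_bool (D + m \<in> u)))"
      using B assms by (simp add: pm card_transversal_Int mult_monom card_Diff_subset)
  qed
  also have "\<dots> = (\<Prod>m=1..r. monom 1 (of_bool (m \<in> u)) + monom (-1) (of_bool (D + m \<in> u)))"
    by (rule prod_add[symmetric]) simp
  also have "\<dots> = (\<Prod>m=1..r. smult (of_bool (m \<in> u) - of_bool (D + m \<in> u)) [:-1, 1:])"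
    by (intro prod.cong refl) (auto simp: monom_0 monom_Suc)
  also have "\<dots> = smult (pair_sign D r u) ([:-1, 1:] ^ r)"
    unfolding prod_smult pair_sign_def by simp
  finally have P: "P = smult (pair_sign D r u) ([:-1, 1:] ^ r)" .
  \<comment> \<open>Every exponent in \<open>P\<close> is at most \<open>r\<close>, so pairing its
    coefficients with \<open>N\<close> over \<open>l \<le> r\<close> loses no term.\<close>
  have le: "card (transversal D r B \<inter> u) \<le> r" if "B \<subseteq> {1..r}" for B
  proof -
    have "finite (transversal D r B)" using that finite_subset by (auto simp: transversal_def)
    then show ?thesis using card_mono[of "transversal D r B" "transversal D r B \<inter> u"]
        card_transversal[OF that assms] by simp
  qed
  have "(\<Sum>B\<in>Pow {1..r}. (-1) ^ (r - card B) * N (card (transversal D r B \<inter> u)))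
    = (\<Sum>B\<in>Pow {1..r}. \<Sum>l\<le>r. coeff (monom ((-1) ^ (r - card B)) (card (transversal D r B \<inter> u))) l * N l)"
  proof (rule sum.cong[OF refl])
    fix B assume "B \<in> Pow {1..r}"
    then have "card (transversal D r B \<inter> u) \<le> r" using le by auto
    then show "(-1) ^ (r - card B) * N (card (transversal D r B \<inter> u)) =
       (\<Sum>l\<le>r. coeff (monom ((-1) ^ (r - card B)) (card (transversal D r B \<inter> u))) l * N l)"
      by (simp add: if_distrib[of "\<lambda>x. x * _"] cong: if_cong)
  qed
  also have "\<dots> = (\<Sum>l\<le>r. coeff P l * N l)"
    unfolding P_def coeff_sum sum_distrib_right by (rule sum.swap)
  also have "\<dots> = (\<Sum>l\<le>r. pair_sign D r u * ((-1) ^ (r - l) * real (r choose l) * N l))"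
    unfolding P by (intro sum.cong refl) (simp add: coeff_linear_poly_power)
  finally show ?thesis by (simp add: sum_distrib_left)
qed

text \<open>The two last factors of the summand for \<open>l\<close> count the sets of size
  \<open>j\<close> that meet a given set of size \<open>i\<close> in \<open>t\<close> points and
  contain a transversal with \<open>l\<close> elements in the given set. Sign and multiplicity are
  the coefficients of \<open>(x - 1) ^ r\<close>.\<close>

definition hahn :: "int \<Rightarrow> int \<Rightarrow> int \<Rightarrow> int \<Rightarrow> int \<Rightarrow> real" where
  "hahn D r i j t = (\<Sum>l=0..r. (-1) powi (r - l) * ibinom r l *
     ibinom (i - l) (t - l) * ibinom (2*D - i - r + l) (j - r - t + l))"

lemma sum_int_atLeast0: "(\<Sum>l=0..int r. f l) = (\<Sum>l\<le>r. f (int l))"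
  by (rule sum.reindex_bij_witness[where i = int and j = nat]) auto

text \<open>After expansion of \<open>pair_sign\<close>, the number of \<open>v\<close> containing a
  given transversal depends only on how many of its elements lie in \<open>u\<close>. Hence
  \<open>sum_transversals\<close> applies and splits off the sign of \<open>u\<close>.\<close>

lemma sum_pair_sign_neighbours:
  assumes r: "r \<le> D" and u: "u \<subseteq> {1..2*D}"
  shows "(\<Sum>v | v \<subseteq> {1..2*D} \<and> card v = j \<and> card (u \<inter> v) = s. pair_sign D r v)
    = pair_sign D r u * hahn (int D) (int r) (int (card u)) (int j) (int s)"
proof -
  let ?V = "{v. v \<subseteq> {1..2*D} \<and> card v = j \<and> card (u \<inter> v) = s}"
  define N where "N l = ibinom (int (card u) - int l) (int s - int l) *
    ibinom (2 * int D - int (card u) - int r + int l) (int j - int r - int s + int l)" for l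
  have finV: "finite ?V" by (rule finite_subset[of _ "Pow {1..2*D}"]) auto
  have "(\<Sum>v\<in>?V. pair_sign D r v)
      = (\<Sum>B\<in>Pow {1..r}. \<Sum>v\<in>?V. (-1) ^ (r - card B) * of_bool (transversal D r B \<subseteq> v))"
    unfolding pair_sign_expand by (rule sum.swap)
  also have "\<dots> = (\<Sum>B\<in>Pow {1..r}. (-1) ^ (r - card B) * N (card (transversal D r B \<inter> u)))"
  proof (rule sum.cong[OF refl])
    fix B assume "B \<in> Pow {1..r}"
    then have B: "B \<subseteq> {1..r}" by auto
    let ?A = "transversal D r B"
    have A: "?A \<subseteq> {1..2*D}" using B r by (auto simp: transversal_def)
    have fA: "finite ?A" using A finite_subset by blast
    have "card (?A - u) = r - card (?A \<inter> u)" "card (?A \<inter> u) \<le> r"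
      using card_transversal[OF B r] fA card_mono[of ?A "?A \<inter> u"] by (auto simp: card_Diff_subset_Int)
    then have d: "int (card (?A - u)) = int r - int (card (?A \<inter> u))" by simp
    have "(\<Sum>v\<in>?V. of_bool (?A \<subseteq> v)) = real (card {v. v \<subseteq> {1..2*D} \<and> ?A \<subseteq> v \<and> card v = j \<and> card (u \<inter> v) = s})"
      using finV by (simp add: Int_def conj_ac)
    also have "\<dots> = N (card (?A \<inter> u))"
      unfolding card_supersets_card_inter[OF finite_atLeastAtMost A u] d N_def by (simp add: algebra_simps)
    finally show "(\<Sum>v\<in>?V. (-1) ^ (r - card B) * of_bool (?A \<subseteq> v)) = (-1) ^ (r - card B) * N (card (?A \<inter> u))"
      by (simp flip: sum_distrib_left)
  qed
  also have "\<dots> = pair_sign D r u * (\<Sum>l\<le>r. (-1) ^ (r - l) * real (r choose l) * N l)"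
    by (rule sum_transversals[OF r])
  also have "(\<Sum>l\<le>r. (-1) ^ (r - l) * real (r choose l) * N l) = hahn (int D) (int r) (int (card u)) (int j) (int s)"
    unfolding hahn_def sum_int_atLeast0 N_def
    by (intro sum.cong refl) (auto simp: power_int_def nat_diff_distrib mult_ac)
  finally show ?thesis .
qed

text \<open>A set that meets each pair once is determined by its trace on \<open>{1..r}\<close> and
  its part outside all pairs. In this form the bijection in \<open>sum_pair_sign_square\<close> can
  be checked by set algebra.\<close>

lemma transversal_decomp:
  assumes "r \<le> D"
  shows "(\<forall>m\<in>{1..r}. m \<in> u \<longleftrightarrow> D + m \<notin> u) \<longleftrightarrow>
    u = transversal D r (u \<inter> {1..r}) \<union> (u - ({1..r} \<union> {D+1..D+r}))" (is "?l \<longleftrightarrow> ?r")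
proof
  assume l: ?l
  show ?r
  proof (intro equalityI subsetI)
    fix x assume x: "x \<in> u"
    show "x \<in> transversal D r (u \<inter> {1..r}) \<union> (u - ({1..r} \<union> {D+1..D+r}))"
    proof (cases "x \<in> {D+1..D+r}")
      case True
      then have *: "x - D \<in> {1..r}" "x = D + (x - D)" by auto
      then have "x - D \<notin> u" using bspec[OF l *(1)] x by simp
      then have "x \<in> (\<lambda>m. D + m) ` ({1..r} - u \<inter> {1..r})" using * by blast
      then show ?thesis unfolding transversal_def by blast
    qed (use x in \<open>auto simp: transversal_def\<close>)
  next
    fix x assume "x \<in> transversal D r (u \<inter> {1..r}) \<union> (u - ({1..r} \<union> {D+1..D+r}))"
    then show "x \<in> u" unfolding transversal_def using l by blast
  qed
next
  assume r: ?r
  show ?l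
  proof
    fix m assume m: "m \<in> {1..r}"
    have "D + m \<in> {1..r} \<union> {D+1..D+r}" using m by auto
    then have "D + m \<in> u \<longleftrightarrow> D + m \<in> transversal D r (u \<inter> {1..r})" using r by blast
    also have "\<dots> \<longleftrightarrow> m \<notin> u" using m assms by (auto simp: transversal_def)
    finally show "m \<in> u \<longleftrightarrow> D + m \<notin> u" by blast
  qed
qed

lemma pair_sign_square:
  "(pair_sign D r u)\<^sup>2 = of_bool (\<forall>m\<in>{1..r}. m \<in> u \<longleftrightarrow> D + m \<notin> u)"
proof -
  have "(pair_sign D r u)\<^sup>2 = (\<Prod>m=1..r. of_bool (m \<in> u \<longleftrightarrow> D + m \<notin> u))"
    unfolding pair_sign_def prod_power_distrib by (intro prod.cong) auto
  then show ?thesis by (simp add: prod_of_bool)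
qed

text \<open>The squares are indicators, so the sum counts the sets of size \<open>i\<close> with
  exactly one element from each of the \<open>r\<close> pairs: \<open>2 ^ r\<close> transversals,
  times the subsets of size \<open>i - r\<close> of the remaining elements.\<close>

lemma sum_pair_sign_square:
  assumes r: "r \<le> D"
  shows "(\<Sum>u | u \<subseteq> {1..2*D} \<and> card u = i. (pair_sign D r u)\<^sup>2)
    = 2 ^ r * ibinom (2 * int D - 2 * int r) (int i - int r)"
proof -
  define Q where "Q = {1..r} \<union> {D+1..D+r}"
  define P where "P u \<longleftrightarrow> (\<forall>m\<in>{1..r}. m \<in> u \<longleftrightarrow> D + m \<notin> u)" for u
  let ?R = "{1..2*D} - Q"
  \<comment> \<open>Writing the size condition as a sum makes the family empty for
    \<open>i < r\<close>, where truncated subtraction would admit the empty set.\<close>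
  let ?T = "{T. T \<subseteq> ?R \<and> card T + r = i}"
  let ?U = "{u. u \<subseteq> {1..2*D} \<and> card u = i}"
  let ?U' = "{u. u \<subseteq> {1..2*D} \<and> card u = i \<and> P u}"
  have P: "P u \<longleftrightarrow> u = transversal D r (u \<inter> {1..r}) \<union> (u - Q)" for u
    unfolding P_def Q_def by (rule transversal_decomp[OF r])
  have QS: "Q \<subseteq> {1..2*D}" "finite Q" and rQ: "{1..r} \<subseteq> Q" using r by (auto simp: Q_def)
  have sub: "transversal D r B \<subseteq> Q" if "B \<subseteq> {1..r}" for B
    using that by (auto simp: transversal_def Q_def)
  have trB: "transversal D r B \<inter> {1..r} = B" if "B \<subseteq> {1..r}" for B
    using that r by (auto simp: transversal_def)
  have dec: "(transversal D r B \<union> T) \<inter> {1..r} = B" "(transversal D r B \<union> T) - Q = T"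
    if "B \<subseteq> {1..r}" "T \<inter> Q = {}" for B T
    using sub[OF that(1)] trB[OF that(1)] rQ that by blast+
  have cardU: "card (transversal D r B \<union> T) = r + card T"
    if "B \<subseteq> {1..r}" "T \<inter> Q = {}" "finite T" for B T
  proof -
    have "finite (transversal D r B)" using sub[OF that(1)] QS finite_subset by auto
    moreover have "transversal D r B \<inter> T = {}" using sub[OF that(1)] that(2) by blast
    ultimately show ?thesis using card_transversal[OF that(1) r] that(3) by (simp add: card_Un_disjoint)
  qed
  have "finite ?U" by (rule finite_subset[of _ "Pow {1..2*D}"]) auto
  then have "(\<Sum>u\<in>?U. (pair_sign D r u)\<^sup>2) = real (card ?U')"
    unfolding pair_sign_square P_def[symmetric] by (simp add: Int_def conj_assoc)
  also have "card ?U' = card (Pow {1..r} \<times> ?T)"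
  proof (rule bij_betw_same_card[symmetric], rule bij_betwI[where g = "\<lambda>u. (u \<inter> {1..r}, u - Q)"])
    show "(\<lambda>(B, T). transversal D r B \<union> T) \<in> Pow {1..r} \<times> ?T \<rightarrow> ?U'"
    proof (rule funcsetI)
      fix q assume "q \<in> Pow {1..r} \<times> ?T"
      then obtain B T where q: "q = (B, T)" and B: "B \<subseteq> {1..r}" and T: "T \<subseteq> ?R" "card T + r = i"
        by auto
      have TQ: "T \<inter> Q = {}" and fT: "finite T" using T finite_subset by auto
      have "card (transversal D r B \<union> T) = i" using cardU[OF B TQ fT] T by simp
      moreover have "P (transversal D r B \<union> T)" unfolding P dec[OF B TQ] ..
      moreover have "transversal D r B \<union> T \<subseteq> {1..2*D}" using sub[OF B] QS T by blast
      ultimately show "(\<lambda>(B, T). transversal D r B \<union> T) q \<in> ?U'" by (simp add: q)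
    qed
    show "(\<lambda>u. (u \<inter> {1..r}, u - Q)) \<in> ?U' \<rightarrow> Pow {1..r} \<times> ?T"
    proof (rule funcsetI)
      fix u assume "u \<in> ?U'"
      then have u: "u \<subseteq> {1..2*D}" "card u = i" "P u" by simp_all
      note uP = u(3)[unfolded P]
      have "finite (u - Q)" using u(1) finite_subset by blast
      then have "card (transversal D r (u \<inter> {1..r}) \<union> (u - Q)) = r + card (u - Q)"
        by (intro cardU) auto
      then have "card (u - Q) + r = i" unfolding uP[symmetric] using u(2) by simp
      then show "(u \<inter> {1..r}, u - Q) \<in> Pow {1..r} \<times> ?T" using u(1) by blast
    qed
    fix x assume "x \<in> Pow {1..r} \<times> ?T"
    then obtain B T where q: "x = (B, T)" and B: "B \<subseteq> {1..r}" and T: "T \<inter> Q = {}" by auto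
    show "(\<lambda>u. (u \<inter> {1..r}, u - Q)) ((\<lambda>(B, T). transversal D r B \<union> T) x) = x"
      unfolding q prod.case dec[OF B T] ..
  next
    fix u assume "u \<in> ?U'"
    then have "P u" by simp
    then have "u = transversal D r (u \<inter> {1..r}) \<union> (u - Q)" unfolding P .
    then show "(\<lambda>(B, T). transversal D r B \<union> T) ((\<lambda>u. (u \<inter> {1..r}, u - Q)) u) = u"
      unfolding prod.case by (rule sym)
  qed
  also have "\<dots> = 2 ^ r * card ?T" by (simp add: card_cartesian_product card_Pow)
  also have "real \<dots> = 2 ^ r * ibinom (2 * int D - 2 * int r) (int i - int r)"
  proof (cases "r \<le> i")
    case True
    have "card Q = r + r" unfolding Q_def using r by (subst card_Un_disjoint) auto
    then have "card ?R = 2 * D - 2 * r" using QS by (simp add: card_Diff_subset)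
    moreover have "?T = {T. T \<subseteq> ?R \<and> card T = i - r}" using True by auto
    ultimately have "card ?T = (2 * D - 2 * r) choose (i - r)"
      using n_subsets[of ?R "i - r"] by simp
    moreover have "2 * int D - 2 * int r = int (2 * D - 2 * r)" "int i - int r = int (i - r)"
      using r True by linarith+
    ultimately show ?thesis by (simp only: ibinom_of_nat of_nat_mult of_nat_power of_nat_numeral)
  next
    case False
    then have "?T = {}" by auto
    then have "card ?T = 0" by (simp only: card.empty)
    then show ?thesis using False by (simp add: ibinom_def)
  qed
  finally show ?thesis by simp
qed

section \<open>The coefficients of the program\<close>

text \<open>The involution sending \<open>l\<close> to \<open>2*h - l\<close> fixes only the middle
  term. The pairing serves both the coefficients at level \<open>D\<close> for even \<open>r\<close>
  and, in the objective, the levels below and above the middle.\<close>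

lemma sum_even_fold_middle:
  fixes G :: "int \<Rightarrow> real"
  assumes "0 \<le> h"
  shows "(\<Sum>l=0..2*h. G l) = (\<Sum>l=h+1..2*h. G l + G (2*h - l)) + G h"
proof -
  have "(\<Sum>l=h+1..2*h. G (2*h - l)) = (\<Sum>l=0..h-1. G l)"
    by (rule sum.reindex_bij_witness[where i = "\<lambda>l. 2*h - l" and j = "\<lambda>l. 2*h - l"]) auto
  moreover have "{0..2*h} = {0..h-1} \<union> {h+1..2*h} \<union> {h}" using assms by auto
  moreover have "(\<Sum>l\<in>{0..h-1} \<union> {h+1..2*h} \<union> {h}. G l) = (\<Sum>l=0..h-1. G l) + (\<Sum>l=h+1..2*h. G l) + G h"
    by (subst sum.union_disjoint, simp, simp, simp, subst sum.union_disjoint) auto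
  ultimately show ?thesis by (simp add: sum.distrib)
qed

text \<open>Each \<open>t\<close> is paired with \<open>n - t\<close> and the larger one represents
  the pair. The self-paired term \<open>2*t = n\<close> occurs once, which is what the halving in
  \<open>beta\<close> accounts for.\<close>

lemma sum_fold_reflect:
  fixes f :: "int \<Rightarrow> real"
  assumes "0 \<le> n"
  shows "(\<Sum>s=0..n. f s) = (\<Sum>t=(n + 1) div 2..n. if 2*t = n then f t else f t + f (n - t))"
proof -
  let ?A = "{(n + 1) div 2..n}" and ?B = "{t\<in>{(n + 1) div 2..n}. 2*t \<noteq> n}" and ?C = "{0..(n + 1) div 2 - 1}"
  have "(\<Sum>t\<in>?A. if 2*t = n then f t else f t + f (n - t)) = (\<Sum>t\<in>?A. f t + (if 2*t \<noteq> n then f (n - t) else 0))"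
    by (intro sum.cong) auto
  also have "\<dots> = (\<Sum>t\<in>?A. f t) + (\<Sum>t\<in>?B. f (n - t))"
    unfolding sum.distrib by (subst sum.inter_filter) simp_all
  also have "(\<Sum>t\<in>?B. f (n - t)) = (\<Sum>t\<in>?C. f t)"
    by (rule sum.reindex_bij_witness[where i = "\<lambda>l. n - l" and j = "\<lambda>l. n - l"]) auto
  also have "(\<Sum>t\<in>?A. f t) + (\<Sum>t\<in>?C. f t) = (\<Sum>t\<in>?A \<union> ?C. f t)"
    by (subst sum.union_disjoint) auto
  also have "?A \<union> ?C = {0..n}" using assms by auto
  finally show ?thesis by simp
qed

lemma ibinom_eq_0: "b < 0 \<or> a < b \<Longrightarrow> ibinom a b = 0"
  by (auto simp: ibinom_def)

lemma sum_ibinom_extend: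
  assumes "0 \<le> a" "r \<le> m"
  shows "(\<Sum>l=a..m. c l * ibinom r l * f l) = (\<Sum>l=a..r. c l * ibinom r l * f l)"
  using assms by (intro sum.mono_neutral_right) (auto simp: ibinom_eq_0)

lemma hahn_extend:
  assumes "r \<le> m"
  shows "hahn D r i j t = (\<Sum>l=0..m. (-1) powi (r - l) * ibinom r l *
     (ibinom (i - l) (t - l) * ibinom (2*D - i - r + l) (j - r - t + l)))"
  unfolding hahn_def sum_ibinom_extend[OF order_refl assms] by (simp add: mult_ac)

text \<open>Both binomial factors are rewritten by their symmetry. For \<open>j = D\<close> the
  result is the second summand of \<open>beta_formula\<close> in the case
  \<open>i < D\<close>.\<close>

lemma hahn_reflect:
  "hahn D r i j (i - t) = (\<Sum>l=0..r. (-1) powi (r - l) * ibinom r l *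
     (ibinom (i - l) t * ibinom (2*D - r - i + l) (2*D - j - t)))"
proof -
  have "ibinom (i - l) (i - t - l) = ibinom (i - l) t" for l
    using ibinom_symmetric[of "i - l" t] by (simp add: algebra_simps)
  moreover have "ibinom (2*D - i - r + l) (j - r - (i - t) + l) = ibinom (2*D - r - i + l) (2*D - j - t)" for l
    using ibinom_symmetric[of "2*D - r - i + l" "2*D - j - t"] by (simp add: algebra_simps)
  ultimately show ?thesis unfolding hahn_def by (simp add: mult.assoc)
qed

text \<open>The terms for \<open>l\<close> and \<open>r - l\<close> are combined: for even
  \<open>r\<close> their signs and outer binomial coefficients agree. The middle term stays single,
  and terms with \<open>l > r\<close> vanish, so the range may end at \<open>D - 1\<close>.\<close>

lemma hahn_even_fold:
  assumes r: "even r" "0 \<le> r" "r < D"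
  shows "hahn D r D j t = (\<Sum>l = r div 2 + 1..D-1. (-1) powi (r - l) * ibinom r l *
           (ibinom (D - l) (t - l) * ibinom (D - r + l) (j - t - r + l) +
            ibinom (D - r + l) (t - r + l) * ibinom (D - l) (j - t - l))) +
        ibinom (D - r div 2) (t - r div 2) * ibinom (D - r div 2) (j - t - r div 2) *
        (-1) powi (r div 2) * ibinom r (r div 2)"
proof -
  obtain h where h: "r = 2*h" using r by auto
  define G where "G l = (-1) powi (r - l) * ibinom r l *
     ibinom (D - l) (t - l) * ibinom (2*D - D - r + l) (j - r - t + l)" for l
  have "hahn D r D j t = (\<Sum>l=0..2*h. G l)" by (simp add: hahn_def G_def h)
  also have "\<dots> = (\<Sum>l=h+1..2*h. G l + G (2*h - l)) + G h"
    using r by (intro sum_even_fold_middle) (simp add: h)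
  also have "(\<Sum>l=h+1..2*h. G l + G (2*h - l)) = (\<Sum>l=h+1..r. (-1) powi (r - l) * ibinom r l *
           (ibinom (D - l) (t - l) * ibinom (D - r + l) (j - t - r + l) +
            ibinom (D - r + l) (t - r + l) * ibinom (D - l) (j - t - l)))"
    unfolding h
  proof (intro sum.cong refl)
    fix l
    have s: "(-1 :: real) powi (r - l) = (-1) powi l"
      using r by (simp add: power_int_minus_left)
    have b: "ibinom r (r - l) = ibinom r l" by (rule ibinom_symmetric)
    have "G (2*h - l) = (-1) powi l * ibinom r (r - l) * ibinom (D - r + l) (t - r + l) * ibinom (D - l) (j - t - l)"
      by (simp add: G_def h algebra_simps)
    moreover have "G l = (-1) powi (r - l) * ibinom r l * ibinom (D - l) (t - l) * ibinom (D - r + l) (j - t - r + l)"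
      by (simp add: G_def algebra_simps)
    ultimately show "G l + G (2*h - l) = (-1) powi (2*h - l) * ibinom (2*h) l *
           (ibinom (D - l) (t - l) * ibinom (D - 2*h + l) (j - t - 2*h + l) +
            ibinom (D - 2*h + l) (t - 2*h + l) * ibinom (D - l) (j - t - l))"
      using b unfolding s[symmetric] h by (simp add: algebra_simps)
  qed
  also have "\<dots> = (\<Sum>l=h+1..D-1. (-1) powi (r - l) * ibinom r l *
           (ibinom (D - l) (t - l) * ibinom (D - r + l) (j - t - r + l) +
            ibinom (D - r + l) (t - r + l) * ibinom (D - l) (j - t - l)))"
    using r by (intro sum_ibinom_extend[symmetric]) (auto simp: h)
  also have "G h = ibinom (D - h) (t - h) * ibinom (D - h) (j - t - h) * (-1) powi h * ibinom r h"
    by (simp add: G_def h algebra_simps)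
  finally show ?thesis by (simp add: h)
qed

text \<open>Replacing \<open>l\<close> by \<open>r - l\<close> exchanges the two binomial factors
  and keeps the sign because \<open>r\<close> is even. Combinatorially, complementing a set of size
  \<open>D\<close> replaces \<open>t\<close> by \<open>j - t\<close>.\<close>

lemma hahn_middle_symmetric:
  assumes r: "even r"
  shows "hahn D r D j (j - t) = hahn D r D j t"
  unfolding hahn_def
proof (rule sum.reindex_bij_witness[where i = "\<lambda>l. r - l" and j = "\<lambda>l. r - l"])
  fix l assume "l \<in> {0..r}"
  have s: "(-1 :: real) powi (r - (r - l)) = (-1) powi (r - l)"
    using r by (simp add: power_int_minus_left)
  show "(-1) powi (r - (r - l)) * ibinom r (r - l) * ibinom (D - (r - l)) (t - (r - l)) *
        ibinom (2 * D - D - r + (r - l)) (j - r - t + (r - l)) =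
        (-1) powi (r - l) * ibinom r l * ibinom (D - l) (j - t - l) *
        ibinom (2 * D - D - r + l) (j - r - (j - t) + l)"
    unfolding s ibinom_symmetric by (simp add: algebra_simps)
qed auto

context
  fixes D r i j t :: int
  assumes r: "0 \<le> r" "r < D"
begin

lemma beta_formula_small:
  assumes "i < D" "j < D"
  shows "beta_formula D r i j t = ibinom (2*D - 2*r) (i - r) * hahn D r i j t"
  using assms r by (simp add: beta_formula_def hahn_extend[of r "D - 1"] mult.assoc)

lemma beta_formula_left:
  assumes "j < D" "even r"
  shows "beta_formula D r D j t = 2 * ibinom (2*D - 2*r) (D - r) * hahn D r D j t"
  using assms r by (simp add: beta_formula_def hahn_even_fold)

text \<open>The two summands of the formula belong to the intersection sizes \<open>t\<close> and
  \<open>i - t\<close>, those of a set at level \<open>D\<close> and of its complement.\<close>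

lemma beta_formula_right:
  assumes "i < D"
  shows "beta_formula D r i D t =
    ibinom (2*D - 2*r) (i - r) * (hahn D r i D t + hahn D r i D (i - t))"
proof -
  let ?c = "\<lambda>l. (-1) powi (r - l) * ibinom r l"
  have "(\<Sum>l=0..D-1. ?c l *
          (ibinom (i - l) (t - l) * ibinom (2*D - r - i + l) (D - r - t + l) +
           ibinom (i - l) t * ibinom (2*D - r - i + l) (D - t)))
    = (\<Sum>l=0..D-1. ?c l * (ibinom (i - l) (t - l) * ibinom (2*D - i - r + l) (D - r - t + l)))
    + (\<Sum>l=0..D-1. ?c l * (ibinom (i - l) t * ibinom (2*D - r - i + l) (2*D - D - t)))"
    unfolding sum.distrib[symmetric] by (intro sum.cong refl) (simp add: algebra_simps)
  also have "\<dots> = hahn D r i D t + hahn D r i D (i - t)"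
    unfolding hahn_reflect using r
    by (subst hahn_extend[of r "D - 1"], simp, subst sum_ibinom_extend) auto
  finally show ?thesis using assms by (simp add: beta_formula_def)
qed

text \<open>By the symmetry of binomial coefficients the bracket of the formula is twice the folded
  form of \<open>hahn\<close>, which together with the leading factor 2 gives 4.\<close>

lemma beta_formula_corner:
  assumes "even r"
  shows "beta_formula D r D D t = 4 * ibinom (2*D - 2*r) (D - r) * hahn D r D D t"
proof -
  have 1: "ibinom (D - r + l) (D - t - r + l) = ibinom (D - r + l) t" for l
    using ibinom_symmetric[of "D - r + l" t] by (simp add: algebra_simps)
  have 2: "ibinom (D - r + l) (t - r + l) = ibinom (D - r + l) (D - t)" for l
    using ibinom_symmetric[of "D - r + l" "D - t"] by (simp add: algebra_simps)
  have 3: "ibinom (D - l) (D - t - l) = ibinom (D - l) t" for l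
    using ibinom_symmetric[of "D - l" t] by (simp add: algebra_simps)
  have 4: "ibinom (D - l) (t - l) = ibinom (D - l) (D - t)" for l
    using ibinom_symmetric[of "D - l" "D - t"] by (simp add: algebra_simps)
  have *: "2 * hahn D r D D t = (\<Sum>l = r div 2 + 1..D-1. 2 * (-1) powi (r - l) * ibinom r l *
           (ibinom (D - l) (t - l) * ibinom (D - r + l) t +
            ibinom (D - l) t * ibinom (D - r + l) (D - t))) +
        2 * (-1) powi (r div 2) * ibinom r (r div 2) *
        ibinom (D - r div 2) (D - t) * ibinom (D - r div 2) t"
    unfolding hahn_even_fold[OF assms r] 1 2 3 4[of "r div 2"] distrib_left[of 2] sum_distrib_left
    by (simp add: mult_ac)
  show ?thesis by (simp add: beta_formula_def *[symmetric])
qed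

end

section \<open>Ranges of the superscript \<open>t\<close>\<close>

lemma index_set_small:
  "\<lbrakk>0 \<le> i; i < D; 0 \<le> j; j < D\<rbrakk> \<Longrightarrow> {t. (i, j, t) \<in> index_set D} = {0..min i j}"
  by (auto simp: index_set_def)

text \<open>For \<open>3 \<le> D\<close> the lower bound on \<open>t\<close> forces
  \<open>D + j - t \<le> 2*D - 2\<close>, so the range is exactly the upper half on which
  \<open>sum_fold_reflect\<close> operates.\<close>

lemma index_set_left:
  assumes "3 \<le> D" "0 \<le> j" "j < D"
  shows "{t. (D, j, t) \<in> index_set D} = {(j + 1) div 2..j}"
  using assms by (auto simp: index_set_def; linarith)

lemma index_set_right:
  assumes "3 \<le> D" "0 \<le> i" "i < D"
  shows "{t. (i, D, t) \<in> index_set D} = {(i + 1) div 2..i}"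
  using assms by (auto simp: index_set_def; linarith)

lemma index_set_corner:
  assumes "3 \<le> D" "odd D"
  shows "{t. (D, D, t) \<in> index_set D} = {(D + 1) div 2..D}"
  using assms by (auto simp: index_set_def elim!: oddE)

section \<open>Positive semidefiniteness of the level matrices\<close>

text \<open>The two overlapping intervals are the standard representatives of a triple of sizes
  \<open>(i, j, t)\<close>.\<close>

lemma canonical_cards:
  fixes i j t :: nat
  assumes "t \<le> i" "t \<le> j"
  shows "card {1..i} = i" "card {i - t + 1..i + j - t} = j"
    "card ({1..i} \<inter> {i - t + 1..i + j - t}) = t"
proof -
  have "{1..i} \<inter> {i - t + 1..i + j - t} = {i - t + 1..i}" using assms by auto
  then show "card ({1..i} \<inter> {i - t + 1..i + j - t}) = t" using assms by simp
qed (use assms in auto)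

text \<open>The kernels centred at words and at non-words share these properties, so both families
  of matrices are treated at once. \<open>Y\<close> gives the value of the kernel in terms of the
  three sizes.\<close>

locale folded_cube_kernel =
  fixes D :: nat and g :: "nat set \<Rightarrow> nat set \<Rightarrow> real" and Y :: "int \<Rightarrow> int \<Rightarrow> int \<Rightarrow> real"
  assumes D: "3 \<le> D" "odd D"
    and g_commute: "g u v = g v u"
    and g_compl: "u \<subseteq> {1..2*D} \<Longrightarrow> v \<subseteq> {1..2*D} \<Longrightarrow> g ({1..2*D} - u) v = g u v"
    and g_type: "u \<subseteq> {1..2*D} \<Longrightarrow> v \<subseteq> {1..2*D} \<Longrightarrow>
      g u v = Y (int (card u)) (int (card v)) (int (card (u \<inter> v)))"
    and g_psd: "0 \<le> (\<Sum>u\<in>Pow {1..2*D}. \<Sum>v\<in>Pow {1..2*D}. W u * W v * g u v)"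
begin

definition level :: "int \<Rightarrow> nat set set" where
  "level i = {u. u \<subseteq> {1..2*D} \<and> int (card u) = i}"

definition level_form :: "nat \<Rightarrow> int \<Rightarrow> int \<Rightarrow> real" where
  "level_form r i j = (\<Sum>u\<in>level i. \<Sum>v\<in>level j. pair_sign D r u * pair_sign D r v * g u v)"

definition beta_matrix :: "nat \<Rightarrow> int \<Rightarrow> int \<Rightarrow> real" where
  "beta_matrix r i j = (\<Sum>t | (i, j, t) \<in> index_set (int D). beta (int D) (int r) i j t * Y i j t)"

lemma finite_level [simp]: "finite (level i)"
  by (rule finite_subset[of _ "Pow {1..2*D}"]) (auto simp: level_def)

lemma level_form_commute: "level_form r i j = level_form r j i"
proof -
  have "level_form r i j = (\<Sum>u\<in>level i. \<Sum>v\<in>level j. pair_sign D r v * pair_sign D r u * g v u)"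
    unfolding level_form_def by (intro sum.cong refl) (simp add: g_commute mult_ac)
  also have "\<dots> = level_form r j i" unfolding level_form_def by (rule sum.swap)
  finally show ?thesis .
qed

text \<open>The complement of a set of size \<open>D\<close> again has size \<open>D\<close>, and it
  meets a set of size \<open>j\<close> in the \<open>j - t\<close> elements that the original one
  misses.\<close>

lemma Y_reflect_left:
  assumes "0 \<le> t" "t \<le> j" "j \<le> int D"
  shows "Y (int D) j (j - t) = Y (int D) j t"
proof -
  obtain t' where [simp]: "t = int t'" by (rule nonneg_int_cases[OF assms(1)])
  obtain j' where [simp]: "j = int j'" by (rule nonneg_int_cases[OF order_trans[OF assms(1,2)]])
  have tj: "t' \<le> j'" "j' \<le> D" "t' \<le> D" using assms by auto
  let ?u = "{1..D}" and ?v = "{D - t' + 1..D + j' - t'}" and ?S = "{1..2*D}"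
  have sub: "?u \<subseteq> ?S" "?v \<subseteq> ?S" using tj by auto
  note c = canonical_cards[OF tj(3,1)]
  have "(?S - ?u) \<inter> ?v = ?v - ?u \<inter> ?v" using sub by auto
  moreover have "card (?v - ?u \<inter> ?v) = card ?v - card (?u \<inter> ?v)" by (rule card_Diff_subset) auto
  ultimately have "card ((?S - ?u) \<inter> ?v) = j' - t'" by (simp only: c)
  moreover have "card (?S - ?u) = D" using sub by (simp add: card_Diff_subset)
  ultimately have "g (?S - ?u) ?v = Y (int D) (int j') (int (j' - t'))"
    using g_type[OF Diff_subset sub(2), of ?u] by (simp only: c)
  moreover have "g ?u ?v = Y (int D) (int j') (int t')" using g_type[OF sub] by (simp only: c)
  ultimately show ?thesis using g_compl[OF sub] tj by (simp add: of_nat_diff)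
qed

lemma Y_commute:
  assumes "0 \<le> t" "t \<le> i" "t \<le> j" "i \<le> int D" "j \<le> int D"
  shows "Y i j t = Y j i t"
proof -
  obtain t' where [simp]: "t = int t'" by (rule nonneg_int_cases[OF assms(1)])
  obtain i' where [simp]: "i = int i'" by (rule nonneg_int_cases[OF order_trans[OF assms(1,2)]])
  obtain j' where [simp]: "j = int j'" by (rule nonneg_int_cases[OF order_trans[OF assms(1,3)]])
  have tj: "t' \<le> j'" "t' \<le> i'" "i' \<le> D" "j' \<le> D" using assms by auto
  let ?u = "{1..i'}" and ?v = "{i' - t' + 1..i' + j' - t'}"
  have sub: "?u \<subseteq> {1..2*D}" "?v \<subseteq> {1..2*D}" using tj by auto
  note c = canonical_cards[OF tj(2,1)]
  show ?thesis
    using g_type[OF sub] g_type[OF sub(2,1)] g_commute[of ?u ?v]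
    unfolding Int_commute[of ?v ?u] c by simp
qed

lemma Y_reflect_right:
  assumes "0 \<le> t" "t \<le> i" "i \<le> int D"
  shows "Y i (int D) (i - t) = Y i (int D) t"
  using Y_reflect_left[OF assms] Y_commute[of t i "int D"] Y_commute[of "i - t" i "int D"] assms by simp

text \<open>For fixed \<open>u\<close> the sets \<open>v\<close> are grouped by
  \<open>card (u \<inter> v)\<close>, on which alone \<open>g\<close> depends between two levels.
  Each group contributes an eigenvalue times \<open>pair_sign D r u\<close>, and the remaining sum
  of squares gives the leading factor.\<close>

lemma level_form_eq:
  assumes r: "r \<le> D" and ij: "0 \<le> i" "0 \<le> j"
  shows "level_form r i j = 2 ^ r * ibinom (2 * int D - 2 * int r) (i - int r) *
    (\<Sum>s=0..min i j. Y i j s * hahn (int D) (int r) i j s)"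
proof -
  obtain i' j' where i: "i = int i'" and j: "j = int j'" using ij by (meson nonneg_int_cases)
  let ?V = "{v. v \<subseteq> {1..2*D} \<and> card v = j'}"
  have lev: "level i = {u. u \<subseteq> {1..2*D} \<and> card u = i'}" "level j = ?V"
    by (auto simp: level_def i j)
  have finV: "finite ?V" using finite_level[of j] by (simp add: lev)
  let ?H = "\<Sum>s\<le>min i' j'. Y i j (int s) * hahn (int D) (int r) i j (int s)"
  have inner: "(\<Sum>v\<in>?V. pair_sign D r u * pair_sign D r v * g u v) = (pair_sign D r u)\<^sup>2 * ?H"
    if u: "u \<subseteq> {1..2*D}" "card u = i'" for u
  proof -
    have fu: "finite u" using u finite_subset by blast
    have im: "(\<lambda>v. card (u \<inter> v)) ` ?V \<subseteq> {..min i' j'}"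
    proof clarsimp
      fix v assume v: "v \<subseteq> {Suc 0..2*D}" "j' = card v"
      then have "finite v" using finite_subset by blast
      then show "card (u \<inter> v) \<le> i' \<and> card (u \<inter> v) \<le> card v"
        using fu u card_mono[of u "u \<inter> v"] card_mono[of v "u \<inter> v"] by simp
    qed
    have "(\<Sum>v\<in>?V. pair_sign D r u * pair_sign D r v * g u v)
      = (\<Sum>s\<le>min i' j'. \<Sum>v\<in>{v\<in>?V. card (u \<inter> v) = s}. pair_sign D r u * pair_sign D r v * g u v)"
      by (rule sum.group[OF finV _ im, symmetric]) simp
    also have "\<dots> = (\<Sum>s\<le>min i' j'. \<Sum>v\<in>{v\<in>?V. card (u \<inter> v) = s}.
        (pair_sign D r u * Y i j (int s)) * pair_sign D r v)"
      by (intro sum.cong refl) (use u in \<open>auto simp: g_type i j\<close>)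
    also have "\<dots> = (\<Sum>s\<le>min i' j'. (pair_sign D r u * Y i j (int s)) *
        (\<Sum>v | v \<subseteq> {1..2*D} \<and> card v = j' \<and> card (u \<inter> v) = s. pair_sign D r v))"
      by (simp add: sum_distrib_left conj_assoc)
    also have "\<dots> = (\<Sum>s\<le>min i' j'. (pair_sign D r u * Y i j (int s)) *
        (pair_sign D r u * hahn (int D) (int r) i j (int s)))"
      unfolding sum_pair_sign_neighbours[OF r u(1)] u(2) i j ..
    also have "\<dots> = (pair_sign D r u)\<^sup>2 * ?H"
      by (simp add: sum_distrib_left power2_eq_square mult_ac)
    finally show ?thesis .
  qed
  have "level_form r i j = (\<Sum>u | u \<subseteq> {1..2*D} \<and> card u = i'. (pair_sign D r u)\<^sup>2 * ?H)"
    unfolding level_form_def lev by (intro sum.cong refl inner) auto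
  also have "\<dots> = 2 ^ r * ibinom (2 * int D - 2 * int r) (int i' - int r) * ?H"
    unfolding sum_distrib_right[symmetric] sum_pair_sign_square[OF r] ..
  also have "?H = (\<Sum>s=0..min i j. Y i j s * hahn (int D) (int r) i j s)"
    using sum_int_atLeast0[where r = "min i' j'", symmetric] by (simp add: i j of_nat_min)
  finally show ?thesis by (simp add: i)
qed

text \<open>Below level \<open>D\<close> the sums agree term by term up to \<open>2 ^ r\<close>. At
  level \<open>D\<close> the sum over all \<open>t\<close> is folded to the half range of the index
  set; the corner \<open>i = j = D\<close> keeps an extra 2, as folding absorbs only one factor 2 of
  its 4.\<close>

lemma beta_matrix_eq:
  assumes r: "r < D" and ij: "0 \<le> i" "i \<le> int D" "0 \<le> j" "j \<le> int D"
    and odd: "odd r \<Longrightarrow> i < int D \<and> j < int D"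
  shows "2 ^ r * beta_matrix r i j =
    (if i = int D \<and> j = int D then 2 else 1) * level_form r i j"
proof -
  have r': "0 \<le> int r" "int r < int D" using r by auto
  let ?c = "ibinom (2 * int D - 2 * int r) (i - int r)"
  let ?h = "hahn (int D) (int r) i j"
  let ?f = "\<lambda>s. Y i j s * ?h s"
  note lf = level_form_eq[OF less_imp_le[OF r] ij(1,3)]
  have D': "3 \<le> int D" "odd (int D)" using D by auto
  consider "i < int D" "j < int D" | "i = int D" "j < int D" | "i < int D" "j = int D"
    | "i = int D" "j = int D" using ij by linarith
  then have "beta_matrix r i j = (if i = int D \<and> j = int D then 2 else 1) * (?c * (\<Sum>s=0..min i j. ?f s))"
  proof cases
    case 1
    have "beta_matrix r i j = (\<Sum>t=0..min i j. ?c * ?f t)"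
      unfolding beta_matrix_def index_set_small[OF ij(1) 1(1) ij(3) 1(2)]
      by (intro sum.cong refl) (use 1 r' in \<open>simp add: beta_def beta_formula_small mult_ac\<close>)
    then show ?thesis using 1 by (simp add: sum_distrib_left)
  next
    case 2
    then have even: "even (int r)" using odd by auto
    have "beta_matrix r i j = (\<Sum>t=(j + 1) div 2..j. ?c * (if 2*t = j then ?f t else ?f t + ?f (j - t)))"
      unfolding beta_matrix_def 2(1) index_set_left[OF D'(1) ij(3) 2(2)]
    proof (intro sum.cong refl)
      fix t assume "t \<in> {(j + 1) div 2..j}"
      then have t: "0 \<le> t" "t \<le> j" using ij by auto
      show "beta (int D) (int r) (int D) j t * Y (int D) j t = ibinom (2 * int D - 2 * int r) (int D - int r) *
          (if 2 * t = j then Y (int D) j t * hahn (int D) (int r) (int D) j t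
           else Y (int D) j t * hahn (int D) (int r) (int D) j t +
            Y (int D) j (j - t) * hahn (int D) (int r) (int D) j (j - t))"
        \<comment> \<open>The two reflected terms coincide, which matches the factor 2 in
          \<open>beta_formula_left\<close>; at \<open>2 * t = j\<close> the halving in
          \<open>beta\<close> removes that factor.\<close>
        unfolding hahn_middle_symmetric[OF even] Y_reflect_left[OF t ij(4)]
        using 2 by (simp add: beta_def beta_formula_left[OF r' 2(2) even])
    qed
    also have "\<dots> = ?c * (\<Sum>s=0..j. ?f s)"
      unfolding sum_fold_reflect[OF ij(3)] sum_distrib_left ..
    finally show ?thesis using 2 ij by (simp add: min_absorb2)
  next
    case 3
    have "beta_matrix r i j = (\<Sum>t=(i + 1) div 2..i. ?c * (if 2*t = i then ?f t else ?f t + ?f (i - t)))"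
      unfolding beta_matrix_def 3(2) index_set_right[OF D'(1) ij(1) 3(1)]
    proof (intro sum.cong refl)
      fix t assume "t \<in> {(i + 1) div 2..i}"
      then have t: "0 \<le> t" "t \<le> i" using ij by auto
      show "beta (int D) (int r) i (int D) t * Y i (int D) t = ?c *
          (if 2 * t = i then Y i (int D) t * hahn (int D) (int r) i (int D) t
           else Y i (int D) t * hahn (int D) (int r) i (int D) t +
            Y i (int D) (i - t) * hahn (int D) (int r) i (int D) (i - t))"
        unfolding Y_reflect_right[OF t ij(2)]
        using 3 by (auto simp: beta_def beta_formula_right[OF r' 3(1)] algebra_simps)
    qed
    also have "\<dots> = ?c * (\<Sum>s=0..i. ?f s)"
      unfolding sum_fold_reflect[OF ij(1)] sum_distrib_left ..
    finally show ?thesis using 3 ij by (simp add: min_absorb1)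
  next
    case 4
    then have even: "even (int r)" using odd by auto
    have "beta_matrix r i j = (\<Sum>t=(j + 1) div 2..j. 2 * (?c * (if 2*t = j then ?f t else ?f t + ?f (j - t))))"
      unfolding beta_matrix_def 4 index_set_corner[OF D']
    proof (intro sum.cong refl)
      fix t assume "t \<in> {(int D + 1) div 2..int D}"
      then have t: "0 \<le> t" "t \<le> int D" by auto
      \<comment> \<open>For odd \<open>D\<close> no superscript is its own reflection, so every term
        of the folded sum is a genuine pair.\<close>
      have "2 * t \<noteq> int D" using D'(2) by (metis dvd_triv_left)
      then show "beta (int D) (int r) (int D) (int D) t * Y (int D) (int D) t =
          2 * (ibinom (2 * int D - 2 * int r) (int D - int r) *
          (if 2 * t = int D then Y (int D) (int D) t * hahn (int D) (int r) (int D) (int D) t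
           else Y (int D) (int D) t * hahn (int D) (int r) (int D) (int D) t +
            Y (int D) (int D) (int D - t) * hahn (int D) (int r) (int D) (int D) (int D - t)))"
        unfolding hahn_middle_symmetric[OF even] Y_reflect_left[OF t order_refl]
        by (simp add: beta_def beta_formula_corner[OF r' even])
    qed
    also have "\<dots> = 2 * (?c * (\<Sum>s=0..j. ?f s))"
      unfolding sum_fold_reflect[OF ij(3)] sum_distrib_left ..
    finally show ?thesis using 4 by simp
  qed
  then show ?thesis unfolding lf by simp
qed

lemma sum_by_level:
  assumes "finite K"
  shows "(\<Sum>u\<in>Pow {1..2*D}. if int (card u) \<in> K then f (int (card u)) u else 0)
    = (\<Sum>i\<in>K. \<Sum>u\<in>level i. f i u :: real)"
proof -
  let ?P = "{u \<in> Pow {1..2*D}. int (card u) \<in> K}"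
  have "(\<Sum>u\<in>Pow {1..2*D}. if int (card u) \<in> K then f (int (card u)) u else 0)
      = (\<Sum>u\<in>?P. f (int (card u)) u)"
    by (rule sum.inter_filter[symmetric]) simp
  also have "\<dots> = (\<Sum>i\<in>K. \<Sum>u\<in>{u\<in>?P. int (card u) = i}. f (int (card u)) u)"
    by (rule sum.group[symmetric]) (use assms in auto)
  also have "\<dots> = (\<Sum>i\<in>K. \<Sum>u\<in>level i. f i u)"
    by (intro sum.cong) (auto simp: level_def)
  finally show ?thesis .
qed

text \<open>This is the form of the kernel itself, evaluated on the combination with coefficients
  \<open>w\<close> of the restrictions of \<open>pair_sign D r\<close> to the levels in
  \<open>K\<close>.\<close>

lemma level_form_psd:
  assumes "finite K"
  shows "0 \<le> (\<Sum>i\<in>K. \<Sum>j\<in>K. w i * w j * level_form r i j)"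
proof -
  define W where "W u = (if int (card u) \<in> K then w (int (card u)) * pair_sign D r u else 0)" for u :: "nat set"
  have "(\<Sum>u\<in>Pow {1..2*D}. \<Sum>v\<in>Pow {1..2*D}. W u * W v * g u v)
    = (\<Sum>u\<in>Pow {1..2*D}. if int (card u) \<in> K then w (int (card u)) * pair_sign D r u *
        (\<Sum>v\<in>Pow {1..2*D}. W v * g u v) else 0)"
    by (intro sum.cong refl) (auto simp: W_def sum_distrib_left mult_ac)
  also have "\<dots> = (\<Sum>i\<in>K. \<Sum>u\<in>level i. w i * pair_sign D r u * (\<Sum>v\<in>Pow {1..2*D}. W v * g u v))"
    by (rule sum_by_level[OF assms])
  also have "\<dots> = (\<Sum>i\<in>K. \<Sum>u\<in>level i. w i * pair_sign D r u *
      (\<Sum>j\<in>K. \<Sum>v\<in>level j. w j * pair_sign D r v * g u v))"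
  proof -
    have "(\<Sum>v\<in>Pow {1..2*D}. W v * g u v) = (\<Sum>j\<in>K. \<Sum>v\<in>level j. w j * pair_sign D r v * g u v)" for u
      unfolding sum_by_level[OF assms, symmetric] by (intro sum.cong refl) (auto simp: W_def)
    then show ?thesis by simp
  qed
  also have "\<dots> = (\<Sum>i\<in>K. \<Sum>u\<in>level i. \<Sum>j\<in>K. \<Sum>v\<in>level j.
      w i * w j * (pair_sign D r u * pair_sign D r v * g u v))"
    unfolding sum_distrib_left by (intro sum.cong refl) (simp add: mult_ac)
  also have "\<dots> = (\<Sum>i\<in>K. \<Sum>j\<in>K. \<Sum>u\<in>level i. \<Sum>v\<in>level j.
      w i * w j * (pair_sign D r u * pair_sign D r v * g u v))"
    by (intro sum.cong refl sum.swap)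
  also have "\<dots> = (\<Sum>i\<in>K. \<Sum>j\<in>K. w i * w j * level_form r i j)"
    unfolding level_form_def sum_distrib_left ..
  finally show ?thesis using g_psd[of W] by simp
qed

text \<open>The coefficients for \<open>i = j = D\<close> are twice the ones of the level form, but doubling a
  diagonal entry of a positive semidefinite matrix preserves positive semidefiniteness.\<close>

lemma beta_matrix_psd:
  assumes r: "r < D" and K: "K \<subseteq> {int r..int D}" and odd: "odd r \<Longrightarrow> int D \<notin> K"
  shows "psd_on K (beta_matrix r)"
  unfolding psd_on_def
proof (intro conjI ballI allI)
  have fin: "finite K" using K finite_subset by blast
  define \<epsilon> where "\<epsilon> i j = (if i = int D \<and> j = int D then 1 else 0 :: real)" for i j
  have eq: "beta_matrix r i j = (1 + \<epsilon> i j) * level_form r i j / 2 ^ r" if "i \<in> K" "j \<in> K" for i j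
  proof -
    have "0 \<le> i" "i \<le> int D" "0 \<le> j" "j \<le> int D" using that K by force+
    moreover have "i < int D \<and> j < int D" if "odd r"
      using odd[OF that] \<open>i \<in> K\<close> \<open>j \<in> K\<close> \<open>i \<le> int D\<close> \<open>j \<le> int D\<close> by (metis order_le_less)
    ultimately have "2 ^ r * beta_matrix r i j = (if i = int D \<and> j = int D then 2 else 1) * level_form r i j"
      by (intro beta_matrix_eq[OF r]) auto
    then show ?thesis by (auto simp: \<epsilon>_def field_simps)
  qed
  show "beta_matrix r i j = beta_matrix r j i" if "i \<in> K" "j \<in> K" for i j
    using eq[OF that] eq[OF that(2,1)] by (simp add: \<epsilon>_def level_form_commute)
  fix w :: "int \<Rightarrow> real"
  have diag: "0 \<le> level_form r i i" for i
    using level_form_psd[of "{i}" "\<lambda>_. 1" r] by simp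
  have "(\<Sum>i\<in>K. \<Sum>j\<in>K. w i * beta_matrix r i j * w j)
      = (\<Sum>i\<in>K. \<Sum>j\<in>K. w i * w j * level_form r i j / 2 ^ r + \<epsilon> i j * (w i * w j * level_form r i j / 2 ^ r))"
    by (intro sum.cong refl) (simp add: eq field_simps)
  also have "\<dots> = (\<Sum>i\<in>K. \<Sum>j\<in>K. w i * w j * level_form r i j) / 2 ^ r
      + (\<Sum>i\<in>K. \<Sum>j\<in>K. \<epsilon> i j * (w i * w j * level_form r i j / 2 ^ r))"
    by (simp add: sum.distrib sum_divide_distrib)
  also have "\<dots> \<ge> 0"
  proof (intro add_nonneg_nonneg divide_nonneg_nonneg level_form_psd[OF fin] sum_nonneg)
    fix i j
    show "0 \<le> \<epsilon> i j * (w i * w j * level_form r i j / 2 ^ r)"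
      using diag by (auto simp: \<epsilon>_def)
  qed simp
  finally show "0 \<le> (\<Sum>i\<in>K. \<Sum>j\<in>K. w i * beta_matrix r i j * w j)" .
qed

end

section \<open>The feasible point defined by a code\<close>

lemma mset3_eq_cases:
  assumes "{#a, b, c#} = {#x, y, z#}"
  obtains "a = x" "b = y" "c = z" | "a = x" "b = z" "c = y" | "a = y" "b = x" "c = z"
    | "a = y" "b = z" "c = x" | "a = z" "b = x" "c = y" | "a = z" "b = y" "c = x"
  using assms by (auto simp: add_eq_conv_ex)

lemma int_card_sym_diff:
  assumes "finite u" "finite v"
  shows "int (card (sym_diff u v)) = int (card u) + int (card v) - 2 * int (card (u \<inter> v))"
proof -
  have "card (sym_diff u v) = card (u - v) + card (v - u)"
    using assms by (intro card_Un_disjoint) auto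
  moreover have "card (u - v) + card (u \<inter> v) = card u" "card (v - u) + card (u \<inter> v) = card v"
    using card_Int_Diff[OF assms(1), of v] card_Int_Diff[OF assms(2), of u] by (simp_all add: Int_commute)
  ultimately show ?thesis by linarith
qed

locale folded_cube_code =
  fixes D d :: nat and C :: "nat set set set"
  assumes D: "3 \<le> D" "odd D" and d: "d \<le> 2 * D"
    and C: "C \<subseteq> folded_cube_verts D" "C \<noteq> {}" "finite C"
    and dist: "\<And>x y. x \<in> C \<Longrightarrow> y \<in> C \<Longrightarrow> x \<noteq> y \<Longrightarrow> d \<le> folded_cube_dist x y"
begin

abbreviation S :: "nat set" where "S \<equiv> {1..2*D}"

definition words :: "nat set set" where "words = \<Union> C"

text \<open>The denominator is the number of pairs of a permutation and a word, so that
  \<open>corr words {} {}\<close> is 1. It stays fixed when \<open>Z\<close> varies, so that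
  removing centres subtracts correlations.\<close>

definition corr :: "nat set set \<Rightarrow> nat set \<Rightarrow> nat set \<Rightarrow> real" where
  "corr Z u v = code_corr S words Z u v / (fact (2*D) * card words)"

text \<open>The value is read off at the standard pair of intervals; by \<open>corr_type\<close> any
  pair of subsets of \<open>S\<close> with the same three sizes gives the same value.\<close>

definition sol :: "int \<Rightarrow> int \<Rightarrow> int \<Rightarrow> real" where
  "sol i j t = corr words {1..nat i} {nat (i - t) + 1..nat (i + j - t)}"

lemma words_subset: "words \<subseteq> Pow S"
  using C(1) folded_cube_rep(1) unfolding words_def by blast

lemma finite_words: "finite words"
  using words_subset finite_subset by blast

lemma words_compl: "c \<in> words \<Longrightarrow> S - c \<in> words"
proof -
  assume "c \<in> words"
  then obtain x where x: "x \<in> C" "c \<in> x" unfolding words_def by blast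
  then have "S - c \<in> x" using folded_cube_rep(2)[OF subsetD[OF C(1) x(1)] x(2)] by blast
  then show "S - c \<in> words" unfolding words_def using x(1) by blast
qed

text \<open>A vertex is determined by either of its members, so distinct vertices are disjoint; the
  two members differ because \<open>S\<close> is nonempty.\<close>

lemma card_words: "card words = 2 * card C"
proof -
  have two: "finite x \<and> card x = 2" if x: "x \<in> C" for x
  proof -
    obtain a where a: "a \<in> x" using x C(1) unfolding folded_cube_verts_def by blast
    note rep = folded_cube_rep[OF subsetD[OF C(1) x] a]
    have "1 \<in> S" using D by simp
    then have "a \<noteq> S - a" by blast
    then have "finite {a, S - a} \<and> card {a, S - a} = 2" by simp
    then show ?thesis unfolding rep(2)[symmetric] .
  qed
  have "pairwise disjnt C"
    unfolding pairwise_def disjnt_iff using C(1) folded_cube_rep(2) by (metis subsetD)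
  then have "card words = (\<Sum>x\<in>C. card x)"
    unfolding words_def using two by (intro card_Union_disjoint) auto
  then show ?thesis using two by simp
qed

text \<open>Words of one vertex are equal or complementary, so the size conditions place
  \<open>a\<close> and \<open>b\<close> in different vertices. The distance bound then applies to
  \<open>b\<close> and to its complement.\<close>

lemma words_dist:
  assumes "a \<in> words" "b \<in> words" "1 \<le> card (sym_diff a b)" "card (sym_diff a b) < 2*D"
  shows "d \<le> card (sym_diff a b)" "d \<le> 2*D - card (sym_diff a b)"
proof -
  obtain x y where x: "x \<in> C" "a \<in> x" and y: "y \<in> C" "b \<in> y" using assms unfolding words_def by blast
  have xy: "x \<in> folded_cube_verts D" "y \<in> folded_cube_verts D" using x y C by auto
  note ra = folded_cube_rep[OF xy(1) x(2)] and rb = folded_cube_rep[OF xy(2) y(2)]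
  have "x \<noteq> y"
  proof
    assume "x = y"
    then have "b = a \<or> b = S - a" using ra(2) y(2) by blast
    then consider "sym_diff a b = {}" | "sym_diff a b = S" using ra(1) by blast
    then show False
    proof cases
      case 1
      then have "card (sym_diff a b) = 0" by (simp only: card.empty)
      then show False using assms(3) by linarith
    next
      case 2
      then have "card (sym_diff a b) = card S" by (simp only:)
      moreover have "card S = 2*D" by simp
      ultimately show False using assms(4) by linarith
    qed
  qed
  then have le: "d \<le> folded_cube_dist x y" using dist x y by blast
  then show "d \<le> card (sym_diff a b)"
    using folded_cube_dist_le[OF xy x(2) y(2)] by simp
  have "S - b \<in> y" using rb(2) by blast
  then have "d \<le> card (sym_diff a (S - b))"
    using folded_cube_dist_le[OF xy x(2)] le order_trans by blast
  moreover have "sym_diff a (S - b) = S - sym_diff a b" using ra(1) rb(1) by blast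
  moreover have "card (S - sym_diff a b) = 2*D - card (sym_diff a b)"
    using ra rb by (subst card_Diff_subset) auto
  ultimately show "d \<le> 2*D - card (sym_diff a b)" by simp
qed

lemma card_words_pos: "0 < card words"
  using C card_words by (simp add: card_gt_0_iff)

lemma norm_pos: "0 < (fact (2*D) * card words :: real)"
  using card_words_pos by simp

lemma corr_commute: "corr Z u v = corr Z v u"
  unfolding corr_def by (simp add: code_corr_commute)

lemma corr_compl:
  assumes "Z \<subseteq> Pow S" "u \<subseteq> S"
  shows "corr Z (S - u) v = corr Z u v" "corr Z v (S - u) = corr Z v u"
proof -
  show "corr Z (S - u) v = corr Z u v"
    unfolding corr_def using code_corr_compl[OF words_subset words_compl assms] by simp
  then show "corr Z v (S - u) = corr Z v u" using corr_commute by metis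
qed

lemma corr_sym_diff: "corr words u (sym_diff u v) = corr words u v"
  unfolding corr_def code_corr_sym_diff[OF finite_words, of S u v] ..

lemma corr_type:
  assumes "u \<subseteq> S" "v \<subseteq> S"
  shows "corr words u v = sol (int (card u)) (int (card v)) (int (card (u \<inter> v)))"
proof -
  define i j t where ijt: "i = card u" "j = card v" "t = card (u \<inter> v)"
  have fin: "finite u" "finite v" using assms finite_subset by blast+
  have t: "t \<le> i" "t \<le> j" unfolding ijt by (intro card_mono fin Int_lower1 Int_lower2)+
  \<comment> \<open>The size of the union bounds the right end of the second interval, which puts
    the standard representatives inside \<open>S\<close>.\<close>
  have "i + j - t = card (u \<union> v)" unfolding ijt using card_Un_Int[OF fin] by simp
  also have "\<dots> \<le> 2*D" using card_mono[of S "u \<union> v"] assms by simp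
  finally have le: "i + j - t \<le> 2*D" .
  have "nat (int i - int t) = i - t" "nat (int i + int j - int t) = i + j - t" "nat (int i) = i"
    using t by auto
  then have "sol (int i) (int j) (int t) = corr words {1..i} {i - t + 1..i + j - t}"
    by (simp only: sol_def)
  also have "\<dots> = corr words u v"
  proof -
    have "i \<le> 2*D" using le t by simp
    then have "{1..i} \<subseteq> S" "{i - t + 1..i + j - t} \<subseteq> S"
      using le by (simp_all add: atLeastatMost_subset_iff)
    note c = canonical_cards[OF t]
    have "code_corr S words words {1..i} {i - t + 1..i + j - t} = code_corr S words words u v"
      by (rule code_corr_cong_card[OF finite_atLeastAtMost \<open>{1..i} \<subseteq> S\<close> \<open>{i - t + 1..i + j - t} \<subseteq> S\<close> assms
            trans[OF c(1) ijt(1)] trans[OF c(2) ijt(2)] trans[OF c(3) ijt(3)]])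
    then show ?thesis by (simp add: corr_def)
  qed
  finally show ?thesis unfolding ijt by (rule sym)
qed

text \<open>The permutation constraints speak of \<open>i + j - 2*t\<close>, so the size of the
  symmetric difference is the convenient third parameter.\<close>

lemma sol_eqI:
  assumes "u \<subseteq> S" "v \<subseteq> S" "int (card u) = i" "int (card v) = j"
    and "int (card (sym_diff u v)) = i + j - 2*t"
  shows "sol i j t = corr words u v"
proof -
  have fin: "finite u" "finite v" using assms finite_subset by blast+
  then have "int (card (u \<inter> v)) = t" using int_card_sym_diff[OF fin] assms by simp
  then show ?thesis using corr_type[OF assms(1,2)] assms by simp
qed

lemma index_set_sets:
  assumes "(i, j, t) \<in> index_set (int D)"
  obtains u v where "u \<subseteq> S" "v \<subseteq> S" "int (card u) = i" "int (card v) = j"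
    "int (card (sym_diff u v)) = i + j - 2*t" "sol i j t = corr words u v" "i \<le> int D" "j \<le> int D"
proof -
  have ijt: "0 \<le> t" "t \<le> i" "t \<le> j" "i \<le> int D" "j \<le> int D" using assms by (auto simp: index_set_def)
  obtain t' where t': "t = int t'" by (rule nonneg_int_cases[OF ijt(1)])
  obtain i' where i': "i = int i'" by (rule nonneg_int_cases[OF order_trans[OF ijt(1,2)]])
  obtain j' where j': "j = int j'" by (rule nonneg_int_cases[OF order_trans[OF ijt(1,3)]])
  note eq = t' i' j'
  have t: "t' \<le> i'" "t' \<le> j'" "i' \<le> D" "j' \<le> D" using ijt eq by auto
  let ?u = "{1..i'}" and ?v = "{i' - t' + 1..i' + j' - t'}"
  have sub: "?u \<subseteq> S" "?v \<subseteq> S" using t by auto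
  note c = canonical_cards[OF t(1,2)]
  have sd: "int (card (sym_diff ?u ?v)) = i + j - 2*t"
    by (subst int_card_sym_diff) (simp_all only: c eq finite_atLeastAtMost)
  have "sol i j t = corr words ?u ?v" by (rule sol_eqI[OF sub _ _ sd]) (simp_all only: c eq)
  then show ?thesis
    using ijt(4,5) by (intro that[OF sub _ _ sd]) (simp_all only: c eq)
qed

lemma corr_kernel:
  assumes Z: "Z \<subseteq> Pow S"
    and Y: "\<And>u v. u \<subseteq> S \<Longrightarrow> v \<subseteq> S \<Longrightarrow>
      corr Z u v = Y (int (card u)) (int (card v)) (int (card (u \<inter> v)))"
  shows "folded_cube_kernel D (corr Z) Y"
proof
  fix W :: "nat set \<Rightarrow> real"
  have "(\<Sum>u\<in>Pow S. \<Sum>v\<in>Pow S. W u * W v * corr Z u v)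
      = (\<Sum>u\<in>Pow S. \<Sum>v\<in>Pow S. W u * W v * code_corr S words Z u v) / (fact (2*D) * card words)"
    by (simp add: corr_def sum_divide_distrib)
  also have "\<dots> \<ge> 0" using norm_pos code_corr_psd by (intro divide_nonneg_nonneg) (auto intro: less_imp_le)
  finally show "0 \<le> (\<Sum>u\<in>Pow S. \<Sum>v\<in>Pow S. W u * W v * corr Z u v)" .
next
  show "corr Z u v = corr Z v u" for u v by (rule corr_commute)
  show "corr Z (S - u) v = corr Z u v" if "u \<subseteq> S" for u v using corr_compl(1)[OF Z that] .
qed (use D Y in auto)

lemma kernel_words: "folded_cube_kernel D (corr words) sol"
  by (rule corr_kernel[OF words_subset corr_type])

text \<open>Translating by a word shows that summing the correlation over all centres, rather than the
  words only, yields the two-point function of the symmetric difference.\<close>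

lemma kernel_non_words:
  "folded_cube_kernel D (corr (Pow S - words)) (\<lambda>i j t. sol (zeta (int D) i j t) 0 0 - sol i j t)"
proof (rule corr_kernel)
  fix u v assume uv: "u \<subseteq> S" "v \<subseteq> S"
  let ?i = "int (card u)" and ?j = "int (card v)" and ?t = "int (card (u \<inter> v))" and ?w = "sym_diff u v"
  have fin: "finite u" "finite v" using uv finite_subset by blast+
  have w: "?w \<subseteq> S" using uv by blast
  have k: "int (card ?w) = ?i + ?j - 2 * ?t" by (rule int_card_sym_diff[OF fin])
  have "corr (Pow S - words) u v = corr (Pow S) u v - corr words u v"
    unfolding corr_def code_corr_Diff[OF finite_Pow_iff[THEN iffD2, OF finite_atLeastAtMost] words_subset]
    by (simp add: diff_divide_distrib)
  also have "corr (Pow S) u v = corr words ?w {}"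
    unfolding corr_def code_corr_Pow[OF finite_atLeastAtMost words_subset uv(1)] ..
  also have "corr words ?w {} = sol (zeta (int D) ?i ?j ?t) 0 0"
  \<comment> \<open>\<open>zeta\<close> selects the smaller of the sizes of \<open>?w\<close> and
    its complement; both sets have the same correlation with \<open>{}\<close>.\<close>
  proof (cases "?i + ?j - 2 * ?t \<le> 2 * int D - (?i + ?j - 2 * ?t)")
    case True
    then have "zeta (int D) ?i ?j ?t = int (card ?w)" unfolding zeta_def k by simp
    then show ?thesis using corr_type[OF w, of "{}"] by simp
  next
    case False
    have "card ?w \<le> 2*D" using card_mono[OF _ w] by simp
    then have "int (card (S - ?w)) = 2 * int D - int (card ?w)"
      using w finite_subset[OF w] by (subst card_Diff_subset) auto
    then have "zeta (int D) ?i ?j ?t = int (card (S - ?w))" using False unfolding zeta_def k by simp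
    moreover have "corr words (S - ?w) {} = corr words ?w {}" by (rule corr_compl[OF words_subset w])
    ultimately show ?thesis using corr_type[of "S - ?w" "{}"] by simp
  qed
  finally show "corr (Pow S - words) u v = sol (zeta (int D) ?i ?j ?t) 0 0 - sol ?i ?j ?t"
    unfolding corr_type[OF uv] .
qed auto

lemma sdp_matrices_psd:
  assumes "0 \<le> r" "r < int D" "K \<subseteq> {r..int D}" "odd r \<Longrightarrow> int D \<notin> K"
  shows "psd_on K (sdp_matrix1 (int D) sol r)" "psd_on K (sdp_matrix2 (int D) sol r)"
proof -
  obtain r' where r: "r = int r'" using assms(1) by (meson nonneg_int_cases)
  note k1 = kernel_words and k2 = kernel_non_words
  have "folded_cube_kernel.beta_matrix D sol r' = sdp_matrix1 (int D) sol r"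
    by (intro ext) (simp add: folded_cube_kernel.beta_matrix_def[OF k1] sdp_matrix1_def r)
  moreover have "folded_cube_kernel.beta_matrix D (\<lambda>i j t. sol (zeta (int D) i j t) 0 0 - sol i j t) r'
      = sdp_matrix2 (int D) sol r"
    by (intro ext) (simp add: folded_cube_kernel.beta_matrix_def[OF k2] sdp_matrix2_def r)
  ultimately show "psd_on K (sdp_matrix1 (int D) sol r)" "psd_on K (sdp_matrix2 (int D) sol r)"
    using folded_cube_kernel.beta_matrix_psd[OF k1, of r' K]
      folded_cube_kernel.beta_matrix_psd[OF k2, of r' K] assms by (auto simp: r)
qed

text \<open>A nonzero correlation supplies three words: a centre and its translates by the images of
  \<open>u\<close> and \<open>v\<close>. Their pairwise differences are the images of
  \<open>u\<close>, \<open>v\<close> and \<open>sym_diff u v\<close>, to which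
  \<open>words_dist\<close> applies.\<close>

lemma corr_nonzero_card:
  assumes nz: "corr words u v \<noteq> 0" and uv: "u \<subseteq> S" "v \<subseteq> S" and w: "w \<in> {u, v, sym_diff u v}"
    and c: "1 \<le> card w" "card w < 2*D"
  shows "d \<le> card w" "d \<le> 2*D - card w"
proof -
  have "code_corr S words words u v \<noteq> 0" using nz by (auto simp: corr_def)
  then obtain p z where p: "p permutes S" and z: "z \<in> words" "sym_diff z (p ` u) \<in> words" "sym_diff z (p ` v) \<in> words"
    by (rule code_corr_nonzeroD)
  have inv: "sym_diff z (sym_diff z a) = a" for a :: "nat set" by blast
  have diff: "sym_diff (sym_diff z (p ` u)) (sym_diff z (p ` v)) = p ` sym_diff u v"
    unfolding image_sym_diff_permutes[OF p] by blast
  consider "w = u" | "w = v" | "w = sym_diff u v" using w by blast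
  then have "\<exists>a\<in>words. \<exists>b\<in>words. sym_diff a b = p ` w"
  proof cases
    case 1
    show ?thesis unfolding 1
    proof (intro bexI)
      show "sym_diff z (sym_diff z (p ` u)) = p ` u" by (rule inv)
    qed (rule z)+
  next
    case 2
    show ?thesis unfolding 2
    proof (intro bexI)
      show "sym_diff z (sym_diff z (p ` v)) = p ` v" by (rule inv)
    qed (rule z)+
  next
    case 3
    show ?thesis unfolding 3
    proof (intro bexI)
      show "sym_diff (sym_diff z (p ` u)) (sym_diff z (p ` v)) = p ` sym_diff u v" by (rule diff)
    qed (rule z)+
  qed
  then obtain a b where ab: "a \<in> words" "b \<in> words" "sym_diff a b = p ` w" by blast
  have "card (p ` w) = card w" using p by (simp add: card_image permutes_inj_on)
  then show "d \<le> card w" "d \<le> 2*D - card w" using words_dist[OF ab(1,2)] ab(3) c by simp_all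
qed

text \<open>Any two of \<open>u\<close>, \<open>v\<close> and \<open>sym_diff u v\<close> have the
  third as their symmetric difference, and every ordered choice of two gives the same correlation.
  The six cases are the orders of the three sizes.\<close>

lemma sol_triple_eq:
  assumes ijt: "(i, j, t) \<in> index_set (int D)"
    and perm: "{#i', j', i' + j' - 2*t'#} = {#i, j, i + j - 2*t#}"
  shows "sol i j t = sol i' j' t'"
proof -
  obtain u v where u: "u \<subseteq> S" "v \<subseteq> S" "int (card u) = i" "int (card v) = j"
    "int (card (sym_diff u v)) = i + j - 2*t" "sol i j t = corr words u v" "i \<le> int D" "j \<le> int D"
    by (rule index_set_sets[OF ijt])
  obtain w where w: "sym_diff u v = w" by blast
  have wS: "w \<subseteq> S" using u w by blast
  have sd: "sym_diff v u = w" "sym_diff u w = v" "sym_diff w u = v" "sym_diff v w = u" "sym_diff w v = u"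
    using w by blast+
  have uw: "corr words u w = corr words u v" using corr_sym_diff[of u v] unfolding w .
  have vw: "corr words v w = corr words u v"
    using corr_sym_diff[of v u] unfolding sd corr_commute[of words v u] .
  note wu = uw[unfolded corr_commute[of words u w]] and wv = vw[unfolded corr_commute[of words v w]]
  have e: "sol i j t = sol i' j' t'"
    if "a \<subseteq> S" "b \<subseteq> S" "sym_diff a b = c" "corr words a b = corr words u v"
      "int (card a) = i'" "int (card b) = j'" "int (card c) = i' + j' - 2*t'" for a b c
    using sol_eqI[OF that(1,2,5,6)] that(3,4,7) u(6) by simp
  note cards = u(3,4) u(5)[unfolded w]
  from perm show ?thesis
  proof (cases rule: mset3_eq_cases)
    case 1 then show ?thesis using cards by (intro e[OF u(1,2) w refl]) linarith+
  next
    case 2 then show ?thesis using cards by (intro e[OF u(1) wS sd(2) uw]) linarith+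
  next
    case 3 then show ?thesis using cards by (intro e[OF u(2,1) sd(1) corr_commute]) linarith+
  next
    case 4 then show ?thesis using cards by (intro e[OF u(2) wS sd(4) vw]) linarith+
  next
    case 5 then show ?thesis using cards by (intro e[OF wS u(1) sd(3) wu]) linarith+
  next
    case 6 then show ?thesis using cards by (intro e[OF wS u(2) sd(5) wv]) linarith+
  qed
qed

text \<open>Here \<open>w\<close> is the complement of \<open>sym_diff u v\<close>. The symmetric
  difference of any two of \<open>u\<close>, \<open>v\<close>, \<open>w\<close> is the complement of
  the third, and correlations are invariant under complements.\<close>

lemma sol_triple_compl_eq:
  assumes ijt: "(i, j, t) \<in> index_set (int D)"
    and perm: "{#i', j', 2 * int D - (i' + j' - 2*t')#} = {#i, j, 2 * int D - (i + j - 2*t)#}"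
  shows "sol i j t = sol i' j' t'"
proof -
  obtain u v where u: "u \<subseteq> S" "v \<subseteq> S" "int (card u) = i" "int (card v) = j"
    "int (card (sym_diff u v)) = i + j - 2*t" "sol i j t = corr words u v" "i \<le> int D" "j \<le> int D"
    by (rule index_set_sets[OF ijt])
  have uvS: "sym_diff u v \<subseteq> S" using u by blast
  obtain w where w: "S - sym_diff u v = w" by blast
  have wS: "w \<subseteq> S" using w by blast
  have sd: "sym_diff v u = sym_diff u v" "sym_diff u w = S - v" "sym_diff w u = S - v"
    "sym_diff v w = S - u" "sym_diff w v = S - u"
    using w u(1,2) by blast+
  have uw: "corr words u w = corr words u v"
    using corr_compl(2)[OF words_subset uvS, of u] unfolding w corr_sym_diff .
  have vw: "corr words v w = corr words u v"
    using corr_compl(2)[OF words_subset uvS, of v] corr_sym_diff[of v u]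
    unfolding w sd corr_commute[of words v u] by simp
  note wu = uw[unfolded corr_commute[of words u w]] and wv = vw[unfolded corr_commute[of words v w]]
  have e: "sol i j t = sol i' j' t'"
    if "a \<subseteq> S" "b \<subseteq> S" "sym_diff a b = c" "corr words a b = corr words u v"
      "int (card a) = i'" "int (card b) = j'" "int (card c) = i' + j' - 2*t'" for a b c
    using sol_eqI[OF that(1,2,5,6)] that(3,4,7) u(6) by simp
  have cS: "int (card (S - a)) = 2 * int D - int (card a)" if "a \<subseteq> S" for a
    using that card_mono[OF _ that] finite_subset[OF that] by (subst card_Diff_subset) auto
  note cards = u(3-5) cS[OF u(1)] cS[OF u(2)] cS[OF uvS, unfolded w]
  from perm show ?thesis
  proof (cases rule: mset3_eq_cases)
    case 1 then show ?thesis using cards by (intro e[OF u(1,2) refl refl]) linarith+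
  next
    case 2 then show ?thesis using cards by (intro e[OF u(1) wS sd(2) uw]) linarith+
  next
    case 3 then show ?thesis using cards by (intro e[OF u(2,1) sd(1) corr_commute]) linarith+
  next
    case 4 then show ?thesis using cards by (intro e[OF u(2) wS sd(4) vw]) linarith+
  next
    case 5 then show ?thesis using cards by (intro e[OF wS u(1) sd(3) wu]) linarith+
  next
    case 6 then show ?thesis using cards by (intro e[OF wS u(2) sd(5) wv]) linarith+
  qed
qed

section \<open>Feasibility and objective value of the point\<close>

lemma sol_feasible: "sol \<in> sdp_feasible (int D) (int d)"
proof -
  have one: "sol 0 0 0 = 1"
    using corr_type[of "{}" "{}"] card_words_pos by (simp add: corr_def code_corr_empty_empty)
  have bounds: "0 \<le> sol i j t \<and> sol i j t \<le> sol i 0 0"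
    if ijt: "(i, j, t) \<in> index_set (int D)" for i j t
  proof -
    obtain u v where u: "u \<subseteq> S" "v \<subseteq> S" "int (card u) = i" "int (card v) = j"
      "int (card (sym_diff u v)) = i + j - 2*t" "sol i j t = corr words u v" "i \<le> int D" "j \<le> int D"
      by (rule index_set_sets[OF ijt])
    have "sol i 0 0 = corr words u {}" using corr_type[OF u(1), of "{}"] u(3) by simp
    moreover have "corr words u v \<le> corr words u {}" "0 \<le> corr words u v"
      unfolding corr_def
      by (intro divide_nonneg_nonneg divide_right_mono code_corr_nonneg code_corr_le_empty
          less_imp_le[OF norm_pos])+
    ultimately show ?thesis unfolding u(6) by simp
  qed
  have zero: "sol i j t = 0" if ijt: "(i, j, t) \<in> index_set (int D)"
    and ne: "{i, j, i + j - 2*t, 2 * int D - (i + j - 2*t)} \<inter> {1..int d - 1} \<noteq> {}" for i j t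
  proof (rule ccontr)
    assume nz: "sol i j t \<noteq> 0"
    obtain u v where u: "u \<subseteq> S" "v \<subseteq> S" "int (card u) = i" "int (card v) = j"
      "int (card (sym_diff u v)) = i + j - 2*t" "sol i j t = corr words u v" "i \<le> int D" "j \<le> int D"
      by (rule index_set_sets[OF ijt])
    note nz' = corr_nonzero_card[OF nz[unfolded u(6)] u(1,2)]
    have bad: False if "w \<in> {u, v, sym_diff u v}" "1 \<le> card w" "card w < 2*D"
      "card w < d \<or> 2*D - card w < d" for w
      using nz'[OF that(1-3)] that(4) by linarith
    consider "i \<in> {1..int d - 1}" | "j \<in> {1..int d - 1}" | "i + j - 2*t \<in> {1..int d - 1}"
      | "2 * int D - (i + j - 2*t) \<in> {1..int d - 1}" using ne by blast
    then show False
    proof cases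
      case 1
      then show False using u(3,7) D by (intro bad[of u]) auto
    next
      case 2
      then show False using u(4,8) D by (intro bad[of v]) auto
    next
      case 3
      then have "1 \<le> card (sym_diff u v)" "card (sym_diff u v) < d" unfolding u(5)[symmetric] by simp_all
      \<comment> \<open>The bound \<open>d \<le> 2*D\<close> keeps the size below that of
        \<open>S\<close>, as \<open>bad\<close> requires.\<close>
      then show False using d by (intro bad[of "sym_diff u v"]) auto
    next
      case 4
      then have "1 \<le> 2 * int D - int (card (sym_diff u v))" "2 * int D - int (card (sym_diff u v)) < int d"
        unfolding u(5)[symmetric] by simp_all
      \<comment> \<open>Now \<open>d \<le> 2*D\<close> makes the symmetric difference nonempty,
        while the positive size of its complement keeps it below \<open>S\<close>.\<close>
      then have "1 \<le> card (sym_diff u v)" "card (sym_diff u v) < 2*D" "2*D - card (sym_diff u v) < d"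
        using d by linarith+
      then show False by (intro bad[of "sym_diff u v"]) auto
    qed
  qed
  have even: "psd_on {r..int D} (sdp_matrix1 (int D) sol r) \<and> psd_on {r..int D} (sdp_matrix2 (int D) sol r)"
    if "r \<in> {0..int D - 1}" "even r" for r
    using that by (intro conjI sdp_matrices_psd) auto
  have odd: "psd_on {r..int D - 1} (sdp_matrix1 (int D) sol r) \<and> psd_on {r..int D - 1} (sdp_matrix2 (int D) sol r)"
    if "r \<in> {1..int D - 2}" "odd r" for r
    using that by (intro conjI sdp_matrices_psd) auto
  show ?thesis
    unfolding sdp_feasible_def mem_Collect_eq
  proof (intro conjI)
    show "\<forall>(i, j, t)\<in>index_set (int D). 0 \<le> sol i j t \<and> sol i j t \<le> sol i 0 0"
      by (clarify, erule bounds)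
    show "\<forall>(i, j, t)\<in>index_set (int D). \<forall>(i', j', t')\<in>index_set (int D).
        0 \<le> i + j - 2*t \<and> i + j - 2*t \<le> int D \<and>
        {#i', j', i' + j' - 2*t'#} = {#i, j, i + j - 2*t#} \<longrightarrow> sol i j t = sol i' j' t'"
      by (clarify, erule sol_triple_eq, assumption)
    show "\<forall>(i, j, t)\<in>index_set (int D). \<forall>(i', j', t')\<in>index_set (int D).
        int D + 1 \<le> i + j - 2*t \<and> i + j - 2*t \<le> 2 * int D - 2 \<and>
        {#i', j', 2 * int D - (i' + j' - 2*t')#} = {#i, j, 2 * int D - (i + j - 2*t)#} \<longrightarrow>
        sol i j t = sol i' j' t'"
      by (clarify, erule sol_triple_compl_eq, assumption)
    show "\<forall>(i, j, t)\<in>index_set (int D).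
        {i, j, i + j - 2*t, 2 * int D - (i + j - 2*t)} \<inter> {1..int d - 1} \<noteq> {} \<longrightarrow> sol i j t = 0"
      using zero by (intro ballI, split prod.split) blast
  qed (use one even odd in auto)
qed

text \<open>The correlations with \<open>{}\<close> over all subsets of \<open>S\<close> add up to
  \<open>card words\<close>, which is twice \<open>card C\<close>. Levels \<open>k\<close> and
  \<open>2 * D - k\<close> contribute equally and level \<open>D\<close> only once, so folding at
  the middle gives twice the objective.\<close>

lemma sol_objective: "sdp_objective (int D) sol = card C"
proof -
  define G where "G k = ibinom (2 * int D) k * sol k 0 0" for k
  have sym: "G (2 * int D - k) = G k" if k0: "0 \<le> k" and k1: "k \<le> 2 * int D" for k
  proof -
    obtain k' where k: "k = int k'" using k0 by (meson nonneg_int_cases)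
    let ?u = "{1..k'}"
    have u: "?u \<subseteq> S" using k1 by (auto simp: k)
    have "card (S - ?u) = 2*D - k'" using u by (subst card_Diff_subset) auto
    then have "sol (2 * int D - k) 0 0 = corr words (S - ?u) {}"
      using corr_type[of "S - ?u" "{}"] k1 by (simp add: k of_nat_diff)
    also have "\<dots> = sol k 0 0"
      using corr_compl[OF words_subset u] corr_type[OF u, of "{}"] by (simp add: k)
    finally show ?thesis by (simp add: G_def ibinom_symmetric)
  qed
  have "real (card words) = (\<Sum>u\<in>Pow S. corr words u {})"
    using sum_code_corr_empty[OF _ words_subset] card_words_pos
    by (simp add: corr_def sum_divide_distrib[symmetric] power2_eq_square)
  also have "\<dots> = (\<Sum>k\<le>2*D. \<Sum>u\<in>{u\<in>Pow S. card u = k}. corr words u {})"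
  proof (rule sum.group[symmetric])
    show "card ` Pow S \<subseteq> {..2*D}"
    proof clarify
      fix u assume "u \<subseteq> S"
      then show "card u \<le> 2*D" using card_mono[of S u] by simp
    qed
  qed auto
  also have "\<dots> = (\<Sum>k\<le>2*D. G (int k))"
  proof (intro sum.cong refl)
    fix k
    have "(\<Sum>u\<in>{u\<in>Pow S. card u = k}. corr words u {}) = (\<Sum>u\<in>{u\<in>Pow S. card u = k}. sol (int k) 0 0)"
    proof (rule sum.cong[OF refl])
      fix u assume "u \<in> {u \<in> Pow S. card u = k}"
      then show "corr words u {} = sol (int k) 0 0" using corr_type[of u "{}"] by simp
    qed
    also have "\<dots> = real (2*D choose k) * sol (int k) 0 0"
      using n_subsets[of S k] by simp
    also have "real (2*D choose k) = ibinom (2 * int D) (int k)"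
      using ibinom_of_nat[of "2*D" k] by simp
    finally show "(\<Sum>u\<in>{u\<in>Pow S. card u = k}. corr words u {}) = G (int k)" by (simp add: G_def)
  qed
  also have "\<dots> = (\<Sum>k=0..2 * int D. G k)" using sum_int_atLeast0[of G "2*D"] by simp
  also have "\<dots> = (\<Sum>l=int D + 1..2 * int D. G l + G (2 * int D - l)) + G (int D)"
    by (rule sum_even_fold_middle) simp
  also have "(\<Sum>l=int D + 1..2 * int D. G l + G (2 * int D - l)) = (\<Sum>l=0..int D - 1. 2 * G l)"
    by (rule sum.reindex_bij_witness[where i = "\<lambda>l. 2 * int D - l" and j = "\<lambda>l. 2 * int D - l"])
      (use sym in auto)
  finally have "2 * sdp_objective (int D) sol = real (card words)"
    unfolding sdp_objective_def G_def by (simp add: sum_distrib_left[symmetric])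
  then show ?thesis by (simp add: card_words)
qed

end

section \<open>The bound for an optimal code\<close>

theorem theorem5p4:
  fixes D d :: nat
  assumes "D \<ge> 3" and "odd D" and "d \<ge> 1" and "d \<le> 2 * D"
  shows "ereal (real (max_code_size (folded_cube_verts D) folded_cube_dist d))
    \<le> sdp_value (int D) (int d)"
proof -
  define V where "V = folded_cube_verts D"
  define code where "code C \<longleftrightarrow> C \<subseteq> V \<and> (\<forall>x\<in>C. \<forall>y\<in>C. x \<noteq> y \<longrightarrow> d \<le> folded_cube_dist x y)" for C
  define N where "N = {card C |C. code C}"
  have max: "max_code_size (folded_cube_verts D) folded_cube_dist d = Max N"
    unfolding max_code_size_def N_def code_def V_def ..
  have "x \<subseteq> Pow {1..2*D}" if "x \<in> V" for x
    using folded_cube_rep(1)[OF that[unfolded V_def]] by blast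
  then have finV: "finite V" by (intro finite_subset[of V "Pow (Pow {1..2*D})"]) auto
  have "N \<subseteq> card ` Pow V" by (auto simp: N_def code_def)
  then have finN: "finite N" using finV finite_subset by blast
  \<comment> \<open>The base vertex alone is a code, so the maximum is at least 1 and is attained by
    a nonempty code.\<close>
  have "{{}, {1..2*D}} \<in> V" using folded_cube_vert[of "{}" D] by (simp add: V_def)
  then have "code {{{}, {1..2*D}}}" unfolding code_def by simp
  then have "card {{{}, {1..2*D}}} \<in> N" unfolding N_def by blast
  then have one: "1 \<in> N" by simp
  have "Max N \<in> N" using finN one by (intro Max_in) auto
  then obtain C where Cmax: "Max N = card C" "code C" unfolding N_def by blast
  have "1 \<le> card C" using Max_ge[OF finN one] Cmax(1) by simp
  \<comment> \<open>Positive cardinality also yields finiteness, since infinite sets have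
    cardinality 0.\<close>
  then have ne: "C \<noteq> {}" "finite C" by (auto intro: card_ge_0_finite)
  have code: "folded_cube_code D d C"
  proof
    show "d \<le> folded_cube_dist x y" if "x \<in> C" "y \<in> C" "x \<noteq> y" for x y
      using Cmax(2) that unfolding code_def by blast
    show "C \<subseteq> folded_cube_verts D" using Cmax(2) unfolding code_def V_def by blast
  qed (fact assms ne)+
  have "ereal (real (card C)) \<le> sdp_value (int D) (int d)"
    unfolding sdp_value_def folded_cube_code.sol_objective[OF code, symmetric]
    by (rule SUP_upper[OF folded_cube_code.sol_feasible[OF code]])
  then show ?thesis unfolding max Cmax(1) .
qed

end
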